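(* Let $G\in\mathscr{B}$ with $\operatorname{diam}(G)\ge 4$ and let $T_G$ be its associated tree. (i) Suppose $\operatorname{diam}(G)$ is even and $C(T_G)=\{z\}$, where $z\in V_1(B)$ for some block $B$ of $G$. Then $C(G)=\{z\}$ if $z\in C_G$, and $C(G)=V_1(B)$ if $z\notin C_G$. (ii) Suppose $\operatorname{diam}(G)$ is odd and $C(T_G)=\{z_1,z_2\}$, where $z_1\in V_1(B)$ and $z_2\in V_2(B)$ for some block $B$ of $G$. Then $C(G)=\{z_1,z_2\}$ if $z_1,z_2\in C_G$; $C(G)=\{z_1\}\cup V_2(B)$ if $z_1\in C_G$ and $z_2\notin C_G$; $C(G)=\{z_2\}\cup V_1(B)$ if $z_1\notin C_G$ and $z_2\in C_G$.
   Context: All graphs are finite, simple and connected. For a connected graph $H$, $e_H(u)=\max\{d_H(u,v):v\in V_H\}$, $\operatorname{rad}(H)=\min_u e_H(u)$, $\operatorname{diam}(H)=\max_u e_H(u)$, and the center $C(H)$ is the set of vertices $u$ with $e_H(u)=\operatorname{rad}(H)$. A block is a maximal connected subgraph without a cut-vertex; $C_G$ is the set of cut-vertices of $G$. A bi-block graph is a connected graph all of whose blocks are complete bipartite graphs. $\mathscr{B}$ is the class of bi-block graphs with at least two blocks in which every block contains at most two cut-vertices of $G$. For a block $B$, $(V_1(B),V_2(B))$ is its bipartition; $B$ is a leaf block if $|V_B\cap C_G|=1$. Vertices of $G$ are labelled $v_1,\dots,v_n$. Construction of $T_G$ (which is a tree): for a block $B$ and $i=1,2$, let $u_i$ be the non-cut-vertex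 of minimum label in $V_i(B)$, if it exists. If $B\neq K_{1,1}$: $NC_B=\{u_2\}$ if $|V_1(B)\cap C_G|=2$; $NC_B=\{u_1\}$ if $|V_2(B)\cap C_G|=2$; $NC_B=\{u_1,u_2\}$ if $B$ is a leaf block; $NC_B=\emptyset$ otherwise. If $B=K_{1,1}$: $NC_B=\{u_1,u_2\}\cap V_B$. $T_G$ is the subgraph of $G$ induced by $\bigcup_B NC_B\cup C_G$. *)

theory Defs
  imports "Graph_Theory.Graph_Theory"
begin

text \<open>Finite simple graphs are the library's \<open>graph\<close>: finite symmetric digraphs without loops and
  without parallel arcs. An edge is thus represented by a pair of opposite arcs.\<close>

section \<open>Distance, eccentricity, radius, diameter, center\<close>

text \<open>In this section \<open>H\<close> is meant to be finite and connected (in particular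
  nonempty); otherwise the values of \<open>LEAST\<close>, \<open>Max\<close> and \<open>Min\<close> carry no meaning.\<close>

definition gdist :: "('a, 'b) pre_digraph \<Rightarrow> 'a \<Rightarrow> 'a \<Rightarrow> nat" where
  "gdist H u v = (LEAST n. \<exists>p. pre_digraph.apath H u p v \<and> length p = n)"

definition ecc :: "('a, 'b) pre_digraph \<Rightarrow> 'a \<Rightarrow> nat" where
  "ecc H u = Max {gdist H u v | v. v \<in> verts H}"

definition rad :: "('a, 'b) pre_digraph \<Rightarrow> nat" where
  "rad H = Min {ecc H u | u. u \<in> verts H}"

definition diam :: "('a, 'b) pre_digraph \<Rightarrow> nat" where
  "diam H = Max {ecc H u | u. u \<in> verts H}"

definition gcenter :: "('a, 'b) pre_digraph \<Rightarrow> 'a set" where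
  "gcenter H = {u \<in> verts H. ecc H u = rad H}"

section \<open>Cut-vertices and blocks\<close>

text \<open>The vertex \<open>v\<close> separates two other vertices of one component of \<open>H\<close>. The plain condition that
  \<open>H - v\<close> is not \<open>connected\<close> would be wrong for a one-vertex graph, because the library does not
  count the empty graph as connected.\<close>

definition cut_vertex :: "('a, 'b) pre_digraph \<Rightarrow> 'a \<Rightarrow> bool" where
  "cut_vertex H v \<longleftrightarrow> v \<in> verts H \<and>
     (\<exists>u \<in> verts H - {v}. \<exists>w \<in> verts H - {v}.
        u \<rightarrow>\<^sup>*\<^bsub>H\<^esub> w \<and> \<not> u \<rightarrow>\<^sup>*\<^bsub>pre_digraph.del_vert H v\<^esub> w)"

definition cut_vertices :: "('a, 'b) pre_digraph \<Rightarrow> 'a set" where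
  "cut_vertices G = {v. cut_vertex G v}"

text \<open>\<open>subgraph\<close> alone also allows asymmetric sub-digraphs; \<open>graph H\<close> excludes these.\<close>

definition nonseparable_subgraph :: "('a, 'b) pre_digraph \<Rightarrow> ('a, 'b) pre_digraph \<Rightarrow> bool" where
  "nonseparable_subgraph H G \<longleftrightarrow>
     subgraph H G \<and> graph H \<and> connected H \<and> (\<forall>v. \<not> cut_vertex H v)"

definition blocks :: "('a, 'b) pre_digraph \<Rightarrow> ('a, 'b) pre_digraph set" where
  "blocks G = {B. nonseparable_subgraph B G \<and>
     (\<forall>H. nonseparable_subgraph H G \<and> subgraph B H \<longrightarrow> H = B)}"

section \<open>Bi-block graphs\<close>

definition bi_block_graph :: "('a, 'b) pre_digraph \<Rightarrow> bool" where
  "bi_block_graph G \<longleftrightarrow> graph G \<and> connected G \<and>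
     (\<forall>B \<in> blocks G. \<exists>m n. m \<ge> 1 \<and> n \<ge> 1 \<and> complete_bipartite_digraph m n B)"

text \<open>The class \<open>\<B>\<close>.\<close>

definition class_B :: "('a, 'b) pre_digraph \<Rightarrow> bool" where
  "class_B G \<longleftrightarrow> bi_block_graph G \<and> card (blocks G) \<ge> 2 \<and>
     (\<forall>B \<in> blocks G. card (verts B \<inter> cut_vertices G) \<le> 2)"

definition bipartition :: "('a, 'b) pre_digraph \<Rightarrow> 'a set \<Rightarrow> 'a set \<Rightarrow> bool" where
  "bipartition B X Y \<longleftrightarrow>
     verts B = X \<union> Y \<and> X \<inter> Y = {} \<and> arcs_ends B \<subseteq> X \<times> Y \<union> Y \<times> X"

definition leaf_block :: "('a, 'b) pre_digraph \<Rightarrow> ('a, 'b) pre_digraph \<Rightarrow> bool" where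
  "leaf_block G B \<longleftrightarrow> card (verts B \<inter> cut_vertices G) = 1"

section \<open>The associated tree\<close>

text \<open>A labelling \<open>v\<^sub>1, \<dots>, v\<^sub>n\<close> of the vertices is given by the function \<open>lab\<close> sending \<open>v\<^sub>i\<close> to \<open>i\<close>.\<close>

definition labelling :: "('a, 'b) pre_digraph \<Rightarrow> ('a \<Rightarrow> nat) \<Rightarrow> bool" where
  "labelling G lab \<longleftrightarrow> bij_betw lab (verts G) {1..card (verts G)}"

text \<open>For \<open>X = V\<^sub>i(B)\<close> this is \<open>{u\<^sub>i}\<close> if \<open>u\<^sub>i\<close> exists, and empty otherwise.\<close>

definition min_non_cut :: "('a, 'b) pre_digraph \<Rightarrow> ('a \<Rightarrow> nat) \<Rightarrow> 'a set \<Rightarrow> 'a set" where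
  "min_non_cut G lab X =
     {u \<in> X - cut_vertices G. \<forall>w \<in> X - cut_vertices G. lab u \<le> lab w}"

text \<open>\<open>V1\<close> and \<open>V2\<close> assign to every block its two partite sets.\<close>

definition NC ::
  "('a, 'b) pre_digraph \<Rightarrow> ('a \<Rightarrow> nat) \<Rightarrow> (('a, 'b) pre_digraph \<Rightarrow> 'a set) \<Rightarrow>
   (('a, 'b) pre_digraph \<Rightarrow> 'a set) \<Rightarrow> ('a, 'b) pre_digraph \<Rightarrow> 'a set" where
  "NC G lab V1 V2 B =
     (let U1 = min_non_cut G lab (V1 B); U2 = min_non_cut G lab (V2 B) in
      if complete_bipartite_digraph 1 1 B then U1 \<union> U2
      else if card (V1 B \<inter> cut_vertices G) = 2 then U2
      else if card (V2 B \<inter> cut_vertices G) = 2 then U1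
      else if leaf_block G B then U1 \<union> U2
      else {})"

definition assoc_tree ::
  "('a, 'b) pre_digraph \<Rightarrow> ('a \<Rightarrow> nat) \<Rightarrow> (('a, 'b) pre_digraph \<Rightarrow> 'a set) \<Rightarrow>
   (('a, 'b) pre_digraph \<Rightarrow> 'a set) \<Rightarrow> ('a, 'b) pre_digraph" where
  "assoc_tree G lab V1 V2 =
     induce_subgraph G ((\<Union>B \<in> blocks G. NC G lab V1 V2 B) \<union> cut_vertices G)"

end

(*
  Moving every vertex outside T_G to a vertex of T_G in the same partite set of its block is a
  graph retraction, so T_G is isometric in G. A block is entered from outside through a unique
  cut-vertex, which gives equal eccentricities in G and T_G on V(T_G). A non-cut-vertex w in the
  partite set X of a block is strictly more eccentric than some vertex of T_G on the other side if
  X contains a cut-vertex, and has the same eccentricity as every vertex of X if X contains none.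
  Hence C(G) is obtained from C(T_G) by adding the partite set of each non-cut-vertex in C(T_G).
*)

theory Submission
  imports Defs
begin

section \<open>Blocks of a connected symmetric relation\<close>

text \<open>Maximality forces a block to be an induced subgraph, so blocks can be handled as vertex
  sets of a symmetric relation, and the return to digraphs is a separate translation. The entrance
  to a block is unique because two entrances would be joined by a path outside it, an ear, and a
  nonseparable set with an ear attached stays nonseparable. Distances from outside therefore split
  at the entrance, and only distances 0, 1, 2 inside one block remain to be compared. The bound of
  two cut-vertices per block drives the strict comparison: a cut-vertex in the side of
  \<open>w\<close> leaves at most one on the other side, and a vertex chosen there, that cut-vertex
  if it exists, is nearer than \<open>w\<close> to every entrance. Of the tree, the argument keeps
  three features: it contains all cut-vertices, it meets every side, and in a leaf block it contains
  a non-cut-vertex of each side that has one.\<close>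

abbreviation rel_on :: "('a \<times> 'a) set \<Rightarrow> 'a set \<Rightarrow> ('a \<times> 'a) set" where
  "rel_on D S \<equiv> D \<inter> S \<times> S"

text \<open>The choices \<open>Z = {}\<close> and \<open>Z = {v}\<close> express that \<open>S\<close> is connected and has no cut-vertex.\<close>

definition nonsep :: "('a \<times> 'a) set \<Rightarrow> 'a set \<Rightarrow> bool" where
  "nonsep D S \<longleftrightarrow> S \<noteq> {} \<and>
     (\<forall>Z a b. (\<exists>v. Z \<subseteq> {v}) \<longrightarrow> a \<in> S - Z \<longrightarrow> b \<in> S - Z \<longrightarrow> (a, b) \<in> (rel_on D (S - Z))\<^sup>*)"

lemma nonsepD:
  "nonsep D S \<Longrightarrow> Z \<subseteq> {v} \<Longrightarrow> a \<in> S - Z \<Longrightarrow> b \<in> S - Z \<Longrightarrow> (a, b) \<in> (rel_on D (S - Z))\<^sup>*"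
  unfolding nonsep_def by blast

text \<open>Walks instead of paths: concatenation is then \<open>relpow_add\<close>, and a map
  sending arcs to arcs carries walks to walks even if it merges vertices.
  \<open>gdist_eq_dst\<close> returns to paths.\<close>

definition dst :: "('a \<times> 'a) set \<Rightarrow> 'a \<Rightarrow> 'a \<Rightarrow> nat" where
  "dst D u v = (LEAST n. (u, v) \<in> D ^^ n)"

lemma dst_le: "(u, v) \<in> D ^^ n \<Longrightarrow> dst D u v \<le> n"
  unfolding dst_def by (rule Least_le)

lemma dst_walk: "(u, v) \<in> D\<^sup>* \<Longrightarrow> (u, v) \<in> D ^^ dst D u v"
  unfolding dst_def by (metis LeastI rtrancl_imp_relpow)

lemma rtrancl_chain:
  assumes "\<And>m. j \<le> m \<Longrightarrow> m < k \<Longrightarrow> (f m, f (Suc m)) \<in> R" "j \<le> k"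
  shows "(f j, f k) \<in> R\<^sup>*"
  using assms(2,1) by (induction k rule: dec_induct) (auto intro: rtrancl.rtrancl_into_rtrancl)

text \<open>If \<open>f i = f j\<close> with \<open>i < j\<close>, omitting the segment between them
  leaves a shorter walk. Injectivity makes the walk usable as an ear.\<close>

lemma shortest_walk_inj:
  assumes "(a, b) \<in> R\<^sup>*"
  obtains n f where "f 0 = a" "f n = b" "\<And>i. i < n \<Longrightarrow> (f i, f (Suc i)) \<in> R"
    "inj_on f {..n}"
proof -
  define n where "n = dst R a b"
  have "(a, b) \<in> R ^^ n"
    unfolding n_def by (rule dst_walk) fact
  then obtain f where f: "f 0 = a" "f n = b" "\<And>i. i < n \<Longrightarrow> (f i, f (Suc i)) \<in> R"
    unfolding relpow_fun_conv by blast
  have "False" if ij: "i < j" "j \<le> n" "f i = f j" for i j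
  proof -
    have "(a, f i) \<in> R ^^ i"
      unfolding relpow_fun_conv using f ij by (intro exI[of _ f]) auto
    moreover have "(f j, b) \<in> R ^^ (n - j)"
      unfolding relpow_fun_conv using f ij by (intro exI[of _ "\<lambda>m. f (m + j)"]) auto
    ultimately have "(a, b) \<in> R ^^ (i + (n - j))"
      using ij unfolding relpow_add by auto
    then have "n \<le> i + (n - j)"
      unfolding n_def by (rule dst_le)
    with ij show False by linarith
  qed
  then have "inj_on f {..n}"
    unfolding inj_on_def by (metis atMost_iff linorder_neqE_nat)
  with f show thesis by (intro that)
qed

locale conn_rel =
  fixes V :: "'a set" and D :: "('a \<times> 'a) set"
  assumes fin: "finite V" and D_sub: "D \<subseteq> V \<times> V" and sym: "sym D" and irrefl: "irrefl D"
    and nonempty: "V \<noteq> {}"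
    and conn: "\<And>u v. u \<in> V \<Longrightarrow> v \<in> V \<Longrightarrow> (u, v) \<in> D\<^sup>*"
begin

abbreviation "d \<equiv> dst D"

lemma D_sym: "(x, y) \<in> D \<Longrightarrow> (y, x) \<in> D"
  using sym by (rule symD)

lemma D_V: "(x, y) \<in> D \<Longrightarrow> x \<in> V \<and> y \<in> V"
  using D_sub by auto

lemma D_irrefl: "(x, x) \<notin> D"
  using irrefl by (rule irreflD)

lemma rel_on_sym: "(x, y) \<in> (rel_on D S)\<^sup>* \<Longrightarrow> (y, x) \<in> (rel_on D S)\<^sup>*"
  by (rule symD[OF sym_rtrancl]) (auto intro: symI D_sym)

lemma walk_sym: "(x, y) \<in> D ^^ n \<Longrightarrow> (y, x) \<in> D ^^ n"
proof (induction n arbitrary: y)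
  case (Suc n)
  then obtain z where "(x, z) \<in> D ^^ n" "(z, y) \<in> D" by auto
  then show ?case by (intro relpow_Suc_I2[OF D_sym] Suc.IH)
qed auto

lemma d_walk: "x \<in> V \<Longrightarrow> y \<in> V \<Longrightarrow> (x, y) \<in> D ^^ d x y"
  by (intro dst_walk conn)

lemma d_sym: "x \<in> V \<Longrightarrow> y \<in> V \<Longrightarrow> d x y = d y x"
  by (rule antisym; rule dst_le, rule walk_sym, rule d_walk)

lemma d_triangle: "x \<in> V \<Longrightarrow> y \<in> V \<Longrightarrow> z \<in> V \<Longrightarrow> d x z \<le> d x y + d y z"
  by (rule dst_le) (auto simp: relpow_add intro: d_walk)

lemma d_refl [simp]: "d x x = 0"
  using dst_le[of x x 0 D] by simp

lemma d_eq_0_iff: "x \<in> V \<Longrightarrow> y \<in> V \<Longrightarrow> d x y = 0 \<longleftrightarrow> x = y"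
  using d_walk[of x y] by auto

lemma d_eq_1: assumes "(x, y) \<in> D" shows "d x y = 1"
proof -
  have "d x y \<le> 1" using assms by (intro dst_le) auto
  moreover have "d x y \<noteq> 0" using assms D_V d_eq_0_iff D_irrefl by blast
  ultimately show ?thesis by linarith
qed

lemma d_ge_2: assumes "x \<in> V" "y \<in> V" "x \<noteq> y" "(x, y) \<notin> D" shows "d x y \<ge> 2"
proof -
  have "d x y \<noteq> 0" using assms d_eq_0_iff by blast
  moreover have "d x y \<noteq> 1" using assms d_walk[of x y] by auto
  ultimately show ?thesis by linarith
qed

section \<open>Blocks, ears and the entrance to a block\<close>

definition block :: "'a set \<Rightarrow> bool" where
  "block S \<longleftrightarrow> S \<subseteq> V \<and> nonsep D S \<and> (\<forall>S'. S \<subseteq> S' \<and> S' \<subseteq> V \<and> nonsep D S' \<longrightarrow> S' = S)"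

lemma block_sub: "block S \<Longrightarrow> S \<subseteq> V"
  and block_nonsep: "block S \<Longrightarrow> nonsep D S"
  and block_nonempty: "block S \<Longrightarrow> S \<noteq> {}"
  and block_max: "block S \<Longrightarrow> S \<subseteq> S' \<Longrightarrow> S' \<subseteq> V \<Longrightarrow> nonsep D S' \<Longrightarrow> S' = S"
  unfolding block_def nonsep_def by blast+

text \<open>After one deletion \<open>S\<close> stays connected, so it suffices that each surviving
  vertex of the ear still reaches a surviving vertex of \<open>S\<close> along the ear, towards
  \<open>p\<close> or towards \<open>q\<close>.\<close>

lemma nonsep_add_ear:
  assumes S: "nonsep D S" and pq: "p \<in> S" "q \<in> S" "p \<noteq> q"
    and f: "(p, f 0) \<in> D" "(f n, q) \<in> D" "\<And>i. i < n \<Longrightarrow> (f i, f (Suc i)) \<in> D"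
    and inj: "inj_on f {..n}" and out: "\<And>i. i \<le> n \<Longrightarrow> f i \<notin> S"
  shows "nonsep D (S \<union> f ` {..n})"
proof -
  let ?S = "S \<union> f ` {..n}"
  have "(a, b) \<in> (rel_on D (?S - Z))\<^sup>*"
    if Z: "Z \<subseteq> {v}" and a: "a \<in> ?S - Z" and b: "b \<in> ?S - Z" for Z v a b
  proof -
    have to_S: "\<exists>s \<in> S - Z. (x, s) \<in> (rel_on D (?S - Z))\<^sup>*" if x: "x \<in> ?S - Z" for x
    proof (cases "x \<in> S")
      case True
      with x show ?thesis by blast
    next
      case False
      then obtain i where i: "i \<le> n" "x = f i" using x by auto
      \<comment> \<open>If both directions were blocked, the two blocking vertices would coincide,
        since \<open>Z\<close> has at most one element. They lie on opposite sides of
        \<open>x\<close> along a path with distinct vertices, so they could only be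
        \<open>x\<close>, which survives.\<close>
      have "(p \<notin> Z \<and> (\<forall>j\<le>i. f j \<notin> Z)) \<or> (q \<notin> Z \<and> (\<forall>j. i \<le> j \<and> j \<le> n \<longrightarrow> f j \<notin> Z))"
      proof (rule ccontr)
        assume "\<not> ?thesis"
        then obtain u u' where u: "u \<in> Z" "u = p \<or> (\<exists>j\<le>i. u = f j)"
          and u': "u' \<in> Z" "u' = q \<or> (\<exists>j. i \<le> j \<and> j \<le> n \<and> u' = f j)" by blast
        have "u = u'" using u(1) u'(1) Z by blast
        moreover have "u \<noteq> x" "u' \<noteq> x" using u(1) u'(1) x by auto
        moreover have "j = k" if "f j = f k" "j \<le> n" "k \<le> n" for j k
          using inj that unfolding inj_on_def by auto
        moreover have "f j \<noteq> p" "f j \<noteq> q" if "j \<le> n" for j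
          using out[OF that] pq by auto
        ultimately show False
          using u(2) u'(2) pq(3) i by (metis le_antisym le_trans)
      qed
      then show ?thesis
      proof
        assume *: "p \<notin> Z \<and> (\<forall>j\<le>i. f j \<notin> Z)"
        have "(f 0, f i) \<in> (rel_on D (?S - Z))\<^sup>*"
          using * i f(3) by (intro rtrancl_chain) auto
        moreover have "(p, f 0) \<in> rel_on D (?S - Z)"
          using * pq f(1) by auto
        ultimately have "(p, x) \<in> (rel_on D (?S - Z))\<^sup>*"
          unfolding i(2) by (rule converse_rtrancl_into_rtrancl[rotated])
        with * pq show ?thesis by (blast intro: rel_on_sym)
      next
        assume *: "q \<notin> Z \<and> (\<forall>j. i \<le> j \<and> j \<le> n \<longrightarrow> f j \<notin> Z)"
        have "(f i, f n) \<in> (rel_on D (?S - Z))\<^sup>*"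
          using * i f(3) by (intro rtrancl_chain) auto
        moreover have "(f n, q) \<in> rel_on D (?S - Z)"
          using * pq f(2) i by auto
        ultimately have "(x, q) \<in> (rel_on D (?S - Z))\<^sup>*"
          unfolding i(2) by (rule rtrancl.rtrancl_into_rtrancl)
        with * pq show ?thesis by blast
      qed
    qed
    obtain s t where st: "s \<in> S - Z" "(a, s) \<in> (rel_on D (?S - Z))\<^sup>*"
      "t \<in> S - Z" "(b, t) \<in> (rel_on D (?S - Z))\<^sup>*"
      using to_S[OF a] to_S[OF b] by blast
    have "(s, t) \<in> (rel_on D (S - Z))\<^sup>*"
      using S Z st by (blast intro: nonsepD)
    then have "(s, t) \<in> (rel_on D (?S - Z))\<^sup>*"
      by (rule rtrancl_mono[THEN subsetD, rotated]) auto
    then show ?thesis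
      by (intro rtrancl_trans[OF st(2) rtrancl_trans[OF _ rel_on_sym[OF st(4)]]])
  qed
  moreover have "?S \<noteq> {}" using pq by auto
  ultimately show ?thesis unfolding nonsep_def by (intro conjI allI impI) (assumption, elim exE)
qed

text \<open>Otherwise a shortest path from \<open>a\<close> to \<open>b\<close> outside
  \<open>S\<close> is an ear between distinct vertices, and attaching it enlarges
  \<open>S\<close>.\<close>

lemma no_ear:
  assumes S: "block S" and pq: "p \<in> S" "q \<in> S"
    and ab: "a \<notin> S" "(p, a) \<in> D" "(b, q) \<in> D" "(a, b) \<in> (rel_on D (- S))\<^sup>*"
  shows "p = q"
proof (rule ccontr)
  assume "p \<noteq> q"
  obtain n f where f: "f 0 = a" "f n = b" "\<And>i. i < n \<Longrightarrow> (f i, f (Suc i)) \<in> rel_on D (- S)"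
    "inj_on f {..n}"
    using shortest_walk_inj[OF ab(4)] by metis
  have out: "f i \<notin> S" if "i \<le> n" for i
    using that f(1) ab(1) f(3)[of "i - 1"] by (cases i) auto
  have "f i \<in> V" if "i \<le> n" for i
    using that f(1) ab(2) f(3)[of "i - 1"] by (cases i) (auto dest: D_V)
  then have sub: "S \<union> f ` {..n} \<subseteq> V" using block_sub[OF S] by auto
  have "nonsep D (S \<union> f ` {..n})"
    using block_nonsep[OF S] pq \<open>p \<noteq> q\<close> ab(2,3) f out by (intro nonsep_add_ear) auto
  then have "S \<union> f ` {..n} = S"
    using block_max[OF S _ sub] by auto
  with ab(1) f(1) show False by auto
qed

text \<open>\<open>p\<close> is the first vertex of the block \<open>S\<close> on some walk from \<open>x\<close>.\<close>

definition gate :: "'a set \<Rightarrow> 'a \<Rightarrow> 'a \<Rightarrow> bool" where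
  "gate S x p \<longleftrightarrow> p \<in> S \<and>
     (x = p \<or> x \<notin> S \<and> (\<exists>b. (x, b) \<in> (rel_on D (- S))\<^sup>* \<and> (b, p) \<in> D))"

text \<open>For \<open>x\<close> outside \<open>S\<close>, the vertices \<open>b\<close> and
  \<open>b'\<close> preceding the two gates are joined outside \<open>S\<close> through
  \<open>x\<close>, which is the configuration of \<open>no_ear\<close>.\<close>

lemma gate_unique:
  assumes "block S" "gate S x p" "gate S x q"
  shows "p = q"
proof (cases "x \<in> S")
  case True
  with assms show ?thesis unfolding gate_def by auto
next
  case False
  with assms obtain b b' where b: "(x, b) \<in> (rel_on D (- S))\<^sup>*" "(b, p) \<in> D"
    "(x, b') \<in> (rel_on D (- S))\<^sup>*" "(b', q) \<in> D" "p \<in> S" "q \<in> S"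
    unfolding gate_def by auto
  have "b \<notin> S" using b(1) False by (cases rule: rtranclE) auto
  with b assms(1) show ?thesis
    by (intro no_ear[of S p q b b']) (auto intro: D_sym rtrancl_trans rel_on_sym)
qed

text \<open>The walk is cut at its first vertex in \<open>S\<close>. The induction peels off the
  first arc, because prepending an arc that starts outside \<open>S\<close> does not move the
  gate.\<close>

lemma gate_walk:
  assumes "(x, s) \<in> D ^^ n" "s \<in> S"
  shows "\<exists>p i j. gate S x p \<and> n = i + j \<and> (x, p) \<in> D ^^ i \<and> (p, s) \<in> D ^^ j"
  using assms
proof (induction n arbitrary: x)
  case 0
  then show ?case by (intro exI[of _ s] exI[of _ 0]) (auto simp: gate_def)
next
  case (Suc n)
  show ?case
  proof (cases "x \<in> S")
    case True
    then show ?thesis using Suc.prems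
      by (intro exI[of _ x] exI[of _ 0] exI[of _ "Suc n"]) (auto simp: gate_def)
  next
    case False
    obtain y where y: "(x, y) \<in> D" "(y, s) \<in> D ^^ n"
      using Suc.prems(1) by (blast dest: relpow_Suc_D2)
    from Suc.IH[OF y(2) Suc.prems(2)] obtain p i j where p: "gate S y p" "n = i + j"
      "(y, p) \<in> D ^^ i" "(p, s) \<in> D ^^ j" by blast
    have "gate S x p"
    proof (cases "y = p")
      case True
      \<comment> \<open>Here \<open>x\<close> itself is the vertex preceding the gate.\<close>
      with p y False show ?thesis unfolding gate_def by blast
    next
      case y_p: False
      then obtain b where "y \<notin> S" "(y, b) \<in> (rel_on D (- S))\<^sup>*" "(b, p) \<in> D"
        using p unfolding gate_def by blast
      moreover have "(x, y) \<in> rel_on D (- S)" using y False \<open>y \<notin> S\<close> by auto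
      ultimately show ?thesis using p False unfolding gate_def
        by (blast intro: converse_rtrancl_into_rtrancl)
    qed
    moreover have "(x, p) \<in> D ^^ Suc i" using y p by (blast intro: relpow_Suc_I2)
    ultimately show ?thesis using p by (intro exI[of _ p] exI[of _ "Suc i"] exI[of _ j]) auto
  qed
qed

lemma gate_mem: "gate S x p \<Longrightarrow> p \<in> S"
  unfolding gate_def by auto

lemma gate_adj: "p \<in> S \<Longrightarrow> y \<notin> S \<Longrightarrow> (p, y) \<in> D \<Longrightarrow> gate S y p"
  unfolding gate_def by (blast intro: D_sym)

lemma gate_neighbour:
  assumes "gate S x p" "x \<notin> S"
  shows "\<exists>y. y \<notin> S \<and> (p, y) \<in> D"
proof -
  obtain b where b: "(x, b) \<in> (rel_on D (- S))\<^sup>*" "(b, p) \<in> D"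
    using assms unfolding gate_def by blast
  have "b \<notin> S" using b(1) assms(2) by (cases rule: rtranclE) auto
  with b show ?thesis by (blast intro: D_sym)
qed

lemma gate_ex:
  assumes "block S" "x \<in> V" shows "\<exists>p. gate S x p"
proof -
  obtain s where "s \<in> S" "s \<in> V" using assms block_nonempty block_sub by blast
  with assms gate_walk[OF d_walk] show ?thesis by blast
qed

text \<open>A shortest walk from \<open>x\<close> to \<open>s\<close> first meets \<open>S\<close>
  in some gate of \<open>x\<close>, and \<open>p\<close> is the only one.\<close>

lemma d_gate:
  assumes "block S" "x \<in> V" "gate S x p" "s \<in> S"
  shows "d x s = d x p + d p s"
proof (rule antisym)
  have sV: "s \<in> V" "p \<in> V" using assms block_sub gate_mem by blast+
  then show "d x s \<le> d x p + d p s" using assms d_triangle by blast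
  obtain p' i j where "gate S x p'" "d x s = i + j" "(x, p') \<in> D ^^ i" "(p', s) \<in> D ^^ j"
    using gate_walk[OF d_walk[OF assms(2) sV(1)] assms(4)] by blast
  moreover from this have "p' = p" using gate_unique[OF assms(1)] assms(3) by blast
  ultimately show "d x p + d p s \<le> d x s"
    by (simp add: add_mono dst_le)
qed

lemma walk_hits:
  assumes "(x, y) \<in> D ^^ n"
  shows "x \<notin> S \<and> y \<notin> S \<and> (x, y) \<in> (rel_on D (- S))\<^sup>* \<or>
    (\<exists>s i j. s \<in> S \<and> n = i + j \<and> (x, s) \<in> D ^^ i \<and> (s, y) \<in> D ^^ j)"
  using assms
proof (induction n arbitrary: y)
  case 0
  then show ?case by (cases "x \<in> S") auto
next
  case (Suc n)
  then obtain z where z: "(x, z) \<in> D ^^ n" "(z, y) \<in> D" by auto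
  from Suc.IH[OF z(1)] show ?case
  proof (elim disjE exE conjE)
    assume *: "x \<notin> S" "z \<notin> S" "(x, z) \<in> (rel_on D (- S))\<^sup>*"
    show ?thesis
    proof (cases "y \<in> S")
      case True
      with Suc.prems show ?thesis
        by (intro disjI2 exI[of _ y] exI[of _ "Suc n"] exI[of _ 0]) auto
    next
      case False
      with * z have "(z, y) \<in> rel_on D (- S)" by auto
      with *(3) have "(x, y) \<in> (rel_on D (- S))\<^sup>*" by (rule rtrancl.rtrancl_into_rtrancl)
      with * False show ?thesis by blast
    qed
  next
    fix s i j assume "s \<in> S" "n = i + j" "(x, s) \<in> D ^^ i" "(s, z) \<in> D ^^ j"
    with z show ?thesis
      by (intro disjI2 exI[of _ s] exI[of _ i] exI[of _ "Suc j"]) auto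
  qed
qed

text \<open>A walk from \<open>x\<close> to \<open>y\<close> avoiding \<open>S\<close> would make
  \<open>q\<close> a second gate of \<open>x\<close>. Hence a shortest walk meets \<open>S\<close>
  in some \<open>s\<close>, and \<open>d_gate\<close> applies to both halves.\<close>

lemma d_across:
  assumes S: "block S" and xy: "x \<in> V" "y \<in> V" and g: "gate S x p" "gate S y q" "p \<noteq> q"
  shows "d x y = d x p + d p q + d q y"
proof (rule antisym)
  have pq: "p \<in> S" "q \<in> S" "p \<in> V" "q \<in> V" using S g gate_mem block_sub by blast+
  show "d x y \<le> d x p + d p q + d q y"
    using d_triangle[of x p y] d_triangle[of p q y] xy pq by linarith
  from walk_hits[OF d_walk[OF xy], of S] show "d x p + d p q + d q y \<le> d x y"
  proof (elim disjE exE conjE)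
    assume *: "x \<notin> S" "y \<notin> S" "(x, y) \<in> (rel_on D (- S))\<^sup>*"
    then obtain b where "(y, b) \<in> (rel_on D (- S))\<^sup>*" "(b, q) \<in> D"
      using g pq unfolding gate_def by blast
    then have "gate S x q" using * pq unfolding gate_def by (blast intro: rtrancl_trans)
    then show ?thesis using gate_unique[OF S g(1)] g(3) by blast
  next
    fix s i j assume s: "s \<in> S" "d x y = i + j" "(x, s) \<in> D ^^ i" "(s, y) \<in> D ^^ j"
    have sV: "s \<in> V" using s S block_sub by blast
    have "d x s \<le> i" "d s y \<le> j" using s by (auto intro: dst_le)
    moreover have "d x s = d x p + d p s" by (rule d_gate) (use S xy g s in auto)
    moreover have "d y s = d y q + d q s" by (rule d_gate) (use S xy g s in auto)
    moreover have "d p q \<le> d p s + d s q" using pq sV by (intro d_triangle)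
    moreover have "d y s = d s y" "d y q = d q y" "d q s = d s q"
      using d_sym xy sV pq by auto
    ultimately show ?thesis using s(2) by linarith
  qed
qed

text \<open>The arc into the gate is recorded as an arc of \<open>D'\<close>: when \<open>D'\<close>
  avoids a vertex, the gate found differs from that vertex.\<close>

lemma first_hit:
  assumes "(y, b) \<in> D'\<^sup>*" "D' \<subseteq> D" "y \<notin> S" "b \<in> S"
  shows "\<exists>p z. gate S y p \<and> (z, p) \<in> D'"
  using assms(1,3)
proof (induction rule: converse_rtrancl_induct)
  case base
  with assms show ?case by auto
next
  case (step y z)
  show ?case
  proof (cases "z \<in> S")
    case True
    have "gate S y z" using True step assms(2) by (intro gate_adj) (auto intro: D_sym)
    with step(1) show ?thesis by blast
  next
    case False
    with step obtain p w where p: "gate S z p" "(w, p) \<in> D'" by blast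
    then obtain b where b: "p \<in> S" "(z, b) \<in> (rel_on D (- S))\<^sup>*" "(b, p) \<in> D"
      using False unfolding gate_def by blast
    have "(y, z) \<in> rel_on D (- S)" using False step assms(2) by auto
    then have "gate S y p"
      using b step(4) unfolding gate_def by (blast intro: converse_rtrancl_into_rtrancl)
    with p show ?thesis by blast
  qed
qed

section \<open>Cut-vertices and intersections of blocks\<close>

definition cuts :: "'a set" where
  "cuts = {c \<in> V. \<exists>a \<in> V - {c}. \<exists>b \<in> V - {c}. (a, b) \<notin> (rel_on D (V - {c}))\<^sup>*}"

lemma cuts_sub: "cuts \<subseteq> V"
  unfolding cuts_def by auto

text \<open>Without such a neighbour, \<open>c\<close> is the gate of no outer vertex, so every
  vertex other than \<open>c\<close> reaches \<open>S - {c}\<close> without touching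
  \<open>c\<close>. As \<open>S - {c}\<close> is connected, \<open>c\<close> would separate
  nothing.\<close>

lemma cut_neighbour:
  assumes S: "block S" and c: "c \<in> S" "c \<in> cuts"
  shows "\<exists>y. y \<notin> S \<and> (c, y) \<in> D"
proof (rule ccontr)
  assume no: "\<not> ?thesis"
  let ?R = "(rel_on D (V - {c}))\<^sup>*"
  have to_S: "\<exists>s \<in> S - {c}. (a, s) \<in> ?R" if a: "a \<in> V - {c}" for a
  proof (cases "a \<in> S")
    case True
    with a show ?thesis by blast
  next
    case False
    obtain p where p: "gate S a p" using gate_ex S a by blast
    then have "p \<noteq> c" "p \<in> S" using no gate_neighbour False gate_mem by blast+
    obtain b where b: "(a, b) \<in> (rel_on D (- S))\<^sup>*" "(b, p) \<in> D"
      using p False \<open>p \<in> S\<close> unfolding gate_def by blast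
    have "rel_on D (- S) \<subseteq> rel_on D (V - {c})" using D_sub c by auto
    then have "(a, b) \<in> ?R" using b(1) rtrancl_mono by blast
    moreover have "b \<notin> S" using b(1) False by (cases rule: rtranclE) auto
    then have "(b, p) \<in> rel_on D (V - {c})" using b(2) \<open>p \<noteq> c\<close> c D_V by blast
    ultimately show ?thesis using \<open>p \<noteq> c\<close> \<open>p \<in> S\<close> by (blast intro: rtrancl.rtrancl_into_rtrancl)
  qed
  have "(a, b) \<in> ?R" if "a \<in> V - {c}" "b \<in> V - {c}" for a b
  proof -
    obtain s t where st: "s \<in> S - {c}" "(a, s) \<in> ?R" "t \<in> S - {c}" "(b, t) \<in> ?R"
      using to_S \<open>a \<in> V - {c}\<close> \<open>b \<in> V - {c}\<close> by blast
    have "(s, t) \<in> (rel_on D (S - {c}))\<^sup>*"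
      using block_nonsep[OF S] st by (intro nonsepD) auto
    moreover have "rel_on D (S - {c}) \<subseteq> rel_on D (V - {c})" using block_sub[OF S] by auto
    ultimately have "(s, t) \<in> ?R" using rtrancl_mono by blast
    then show ?thesis
      by (intro rtrancl_trans[OF st(2) rtrancl_trans[OF _ rel_on_sym[OF st(4)]]])
  qed
  with c(2) show False unfolding cuts_def by blast
qed

text \<open>The gate of \<open>y\<close> is \<open>c\<close>, so a walk from \<open>y\<close> to
  \<open>b\<close> avoiding \<open>c\<close> would enter \<open>S\<close> through a second
  gate.\<close>

lemma cutI:
  assumes S: "block S" and c: "c \<in> S" "(c, y) \<in> D" "y \<notin> S" and b: "b \<in> S" "b \<noteq> c"
  shows "c \<in> cuts"
proof -
  have "(y, b) \<notin> (rel_on D (V - {c}))\<^sup>*"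
  proof
    assume "(y, b) \<in> (rel_on D (V - {c}))\<^sup>*"
    from first_hit[OF this _ c(3) b(1)] obtain p where "gate S y p" "p \<noteq> c" by blast
    moreover have "gate S y c" using c by (intro gate_adj)
    ultimately show False using gate_unique[OF S] by blast
  qed
  moreover have "y \<in> V - {c}" "b \<in> V - {c}" "c \<in> V" using D_V c b block_sub[OF S] by blast+
  ultimately show ?thesis unfolding cuts_def by blast
qed

text \<open>If \<open>z\<close> in \<open>S' - S\<close> has gate \<open>p\<close> into
  \<open>S\<close>, one of the two shared vertices differs from \<open>p\<close> and is reached from
  \<open>z\<close> inside \<open>S' - {p}\<close>, hence through a second gate.\<close>

lemma blocks_share_one:
  assumes S: "block S" and S': "block S'" and xy: "x \<in> S" "x \<in> S'" "y \<in> S" "y \<in> S'" "x \<noteq> y"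
  shows "S = S'"
proof (rule ccontr)
  assume "S \<noteq> S'"
  then have "\<not> S' \<subseteq> S" using block_max[OF S' _ block_sub[OF S] block_nonsep[OF S]] by blast
  then obtain z where z: "z \<in> S'" "z \<notin> S" by blast
  obtain p where p: "gate S z p" using gate_ex[OF S] z block_sub[OF S'] by blast
  obtain t where t: "t \<in> S" "t \<in> S'" "t \<noteq> p" using xy by metis
  have "p \<in> S" using p gate_mem by blast
  then have "(z, t) \<in> (rel_on D (S' - {p}))\<^sup>*"
    using block_nonsep[OF S'] z t by (intro nonsepD) auto
  from first_hit[OF this _ z(2) t(1)] obtain q where "gate S z q" "q \<noteq> p" by blast
  with p gate_unique[OF S] show False by blast
qed

lemma nonsep_in_block:
  assumes "nonsep D A" "A \<subseteq> V" shows "\<exists>S. block S \<and> A \<subseteq> S"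
proof -
  let ?A = "{S. S \<subseteq> V \<and> nonsep D S}"
  have "finite ?A" using fin by (auto intro: finite_subset[of _ "Pow V"])
  moreover have "A \<in> ?A" using assms by auto
  ultimately have "\<exists>S \<in> ?A. A \<subseteq> S \<and> (\<forall>S' \<in> ?A. S \<subseteq> S' \<longrightarrow> S = S')"
    by (rule finite_has_maximal2)
  then obtain S where "S \<in> ?A" "A \<subseteq> S" "\<forall>S' \<in> ?A. S \<subseteq> S' \<longrightarrow> S = S'"
    by (elim bexE conjE)
  then have "block S" "A \<subseteq> S" unfolding block_def by auto
  then show ?thesis by blast
qed

lemma edge_in_block:
  assumes "(u, v) \<in> D" shows "\<exists>S. block S \<and> u \<in> S \<and> v \<in> S"
proof -
  have "nonsep D {u, v}"
    unfolding nonsep_def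
  proof (intro conjI allI impI)
    fix Z a b assume "a \<in> {u, v} - Z" "b \<in> {u, v} - Z"
    then have "a = b \<or> (a, b) \<in> rel_on D ({u, v} - Z)" using assms D_sym by auto
    then show "(a, b) \<in> (rel_on D ({u, v} - Z))\<^sup>*" by auto
  qed auto
  from nonsep_in_block[OF this] show ?thesis using assms D_V by auto
qed

lemma vertex_in_block:
  assumes "v \<in> V" shows "\<exists>S. block S \<and> v \<in> S"
proof -
  have "nonsep D {v}" unfolding nonsep_def by auto
  from nonsep_in_block[OF this] show ?thesis using assms by auto
qed

section \<open>Complete bipartite blocks and the distances inside them\<close>

definition sides :: "'a set \<Rightarrow> 'a set \<Rightarrow> 'a set \<Rightarrow> bool" where
  "sides S X Y \<longleftrightarrow> block S \<and> S = X \<union> Y \<and> X \<inter> Y = {} \<and> X \<noteq> {} \<and> Y \<noteq> {} \<and>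
     rel_on D S = X \<times> Y \<union> Y \<times> X"

lemma sides_sym: "sides S X Y \<Longrightarrow> sides S Y X"
  unfolding sides_def by auto

lemma sides_block: "sides S X Y \<Longrightarrow> block S"
  and sides_Un: "sides S X Y \<Longrightarrow> S = X \<union> Y"
  and sides_disj: "sides S X Y \<Longrightarrow> x \<in> X \<Longrightarrow> x \<notin> Y"
  unfolding sides_def by auto

lemma sides_V: "sides S X Y \<Longrightarrow> x \<in> S \<Longrightarrow> x \<in> V"
  using sides_block block_sub by blast

lemma sides_adj: "sides S X Y \<Longrightarrow> x \<in> X \<Longrightarrow> y \<in> Y \<Longrightarrow> (x, y) \<in> D"
  unfolding sides_def by auto

lemma sides_adjD: "sides S X Y \<Longrightarrow> x \<in> X \<Longrightarrow> y \<in> S \<Longrightarrow> (x, y) \<in> D \<Longrightarrow> y \<in> Y"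
  unfolding sides_def by auto

text \<open>In both partitions the side opposite \<open>z\<close> is the set of neighbours of
  \<open>z\<close> inside \<open>S\<close>.\<close>

lemma sides_unique:
  assumes "sides S X Y" "sides S X' Y'" "z \<in> X" "z \<in> X'"
  shows "X' = X \<and> Y' = Y"
proof -
  have "Y' = Y"
    using assms sides_adj sides_adjD sides_Un by blast
  moreover have "X = S - Y" "X' = S - Y'"
    using assms unfolding sides_def by auto
  ultimately show ?thesis by simp
qed

lemma sides_d_opposite: "sides S X Y \<Longrightarrow> x \<in> X \<Longrightarrow> y \<in> Y \<Longrightarrow> d x y = 1"
  using sides_adj d_eq_1 by blast

lemma sides_d_same:
  assumes "sides S X Y" "x \<in> X" "x' \<in> X" "x \<noteq> x'" shows "d x x' = 2"
proof (rule antisym)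
  have xV: "x \<in> V" "x' \<in> V" using assms sides_V sides_Un by blast+
  obtain y where y: "y \<in> Y" "y \<in> V" using assms sides_V unfolding sides_def by blast
  have "d x x' \<le> d x y + d y x'" using xV y by (intro d_triangle)
  then show "d x x' \<le> 2"
    using sides_d_opposite[OF assms(1) _ y(1)] sides_d_opposite[OF sides_sym[OF assms(1)] y(1)]
      assms by simp
  have "(x, x') \<notin> D" using assms sides_adjD sides_Un sides_disj by blast
  then show "2 \<le> d x x'" using xV assms by (intro d_ge_2)
qed

lemma sides_d_le_2:
  assumes "sides S X Y" "x \<in> S" "y \<in> S" shows "d x y \<le> 2"
proof -
  have "x = y \<or> (x \<in> X \<and> y \<in> X \<and> x \<noteq> y) \<or> (x \<in> Y \<and> y \<in> Y \<and> x \<noteq> y) \<or> (x \<in> X \<and> y \<in> Y) \<or>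
      (x \<in> Y \<and> y \<in> X)"
    using assms sides_Un by blast
  then show ?thesis
    using sides_d_same[OF assms(1)] sides_d_same[OF sides_sym[OF assms(1)]]
      sides_d_opposite[OF assms(1)] sides_d_opposite[OF sides_sym[OF assms(1)]]
    by fastforce
qed

lemma sides_cutI:
  assumes XY: "sides S X Y" and c: "c \<in> S" "(c, y) \<in> D" "y \<notin> S"
  shows "c \<in> cuts"
proof -
  obtain x x' where x: "x \<in> X" "x' \<in> Y" using XY unfolding sides_def by blast
  then have "x \<in> S" "x' \<in> S" "x \<noteq> x'" using XY sides_Un sides_disj by blast+
  then obtain b where "b \<in> S" "b \<noteq> c" by metis
  then show ?thesis using cutI sides_block[OF XY] c by blast
qed

lemma sides_has_cut:
  assumes XY: "sides S X Y" and "S \<noteq> V"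
  shows "\<exists>c. c \<in> S \<and> c \<in> cuts"
proof -
  have S: "block S" using XY by (rule sides_block)
  obtain x where "x \<in> V" "x \<notin> S" using S assms(2) block_sub by blast
  then obtain p y where "p \<in> S" "y \<notin> S" "(p, y) \<in> D"
    using gate_ex[OF S] gate_neighbour gate_mem by blast
  then show ?thesis using sides_cutI XY by blast
qed

end

section \<open>Eccentricities in a bi-block graph\<close>

definition eccr :: "'a set \<Rightarrow> ('a \<times> 'a) set \<Rightarrow> 'a \<Rightarrow> nat" where
  "eccr V D u = Max {dst D u v | v. v \<in> V}"

lemma eccr_ge: "finite V \<Longrightarrow> v \<in> V \<Longrightarrow> dst D u v \<le> eccr V D u"
  unfolding eccr_def by (rule Max_ge) auto

lemma eccr_attained:
  assumes "finite V" "V \<noteq> {}" shows "\<exists>v \<in> V. eccr V D u = dst D u v"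
proof -
  have "eccr V D u \<in> {dst D u v | v. v \<in> V}"
    unfolding eccr_def by (rule Max_in) (use assms in auto)
  then show ?thesis by auto
qed

definition centre :: "'a set \<Rightarrow> ('a \<times> 'a) set \<Rightarrow> 'a set" where
  "centre V D = {u \<in> V. \<forall>v \<in> V. eccr V D u \<le> eccr V D v}"

text \<open>\<open>W\<close> plays the role of the vertex set of the associated tree.\<close>

locale bi_block_rel = conn_rel +
  fixes W :: "'a set"
  assumes sides_ex: "\<And>S. block S \<Longrightarrow> \<exists>X Y. sides S X Y"
    and two_cuts: "\<And>S. block S \<Longrightarrow> card (S \<inter> cuts) \<le> 2"
    and block_proper: "\<And>S. block S \<Longrightarrow> S \<noteq> V"
    and cuts_W: "cuts \<subseteq> W" and W_V: "W \<subseteq> V"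
    and W_side: "\<And>S X Y. sides S X Y \<Longrightarrow> X \<inter> W \<noteq> {}"
    and W_leaf: "\<And>S X Y w. sides S X Y \<Longrightarrow> card (S \<inter> cuts) = 1 \<Longrightarrow> w \<in> X - cuts \<Longrightarrow>
      \<exists>u \<in> X - cuts. u \<in> W"
begin

abbreviation "e \<equiv> eccr V D"

lemma sides_at: "block S \<Longrightarrow> x \<in> S \<Longrightarrow> \<exists>X Y. sides S X Y \<and> x \<in> X"
  using sides_ex sides_sym sides_Un by blast

lemma gate_cut: "block S \<Longrightarrow> gate S x p \<Longrightarrow> x \<notin> S \<Longrightarrow> p \<in> cuts"
  using gate_neighbour sides_cutI sides_ex gate_mem by metis

lemma block_has_cut: "block S \<Longrightarrow> \<exists>c. c \<in> S \<and> c \<in> cuts"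
  using sides_ex sides_has_cut block_proper by metis

text \<open>A second block through \<open>z\<close> contains a neighbour of \<open>z\<close>, which
  lies outside the first block because distinct blocks share at most one vertex. This makes
  \<open>z\<close> a cut-vertex.\<close>

lemma noncut_block_unique:
  assumes "block S" "block S'" "z \<in> S" "z \<in> S'" "z \<notin> cuts"
  shows "S = S'"
proof (rule ccontr)
  assume ne: "S \<noteq> S'"
  obtain X Y where XY: "sides S' X Y" "z \<in> X" using assms sides_at by blast
  then obtain y where "y \<in> Y" unfolding sides_def by blast
  with XY have y: "(z, y) \<in> D" "y \<in> S'" "y \<noteq> z" using sides_adj sides_Un sides_disj by blast+
  then have "y \<notin> S" using blocks_share_one ne assms by blast
  with assms y show False using sides_cutI sides_ex by metis
qed

text \<open>Source of the lower bounds on distances and eccentricities. Another block through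
  \<open>c\<close> continues outside \<open>S\<close>, and \<open>W\<close> meets its side opposite
  \<open>c\<close>.\<close>

lemma beyond_cut:
  assumes S: "block S" and c: "c \<in> S" "c \<in> cuts"
  shows "\<exists>y \<in> W. y \<notin> S \<and> gate S y c \<and> d y c = 1"
proof -
  obtain z where z: "z \<notin> S" "(c, z) \<in> D" using cut_neighbour assms by blast
  obtain S' where S': "block S'" "c \<in> S'" "z \<in> S'" using edge_in_block z by blast
  obtain X Y where XY: "sides S' X Y" "c \<in> X" using S' sides_at by blast
  obtain y where y: "y \<in> Y" "y \<in> W" using W_side sides_sym XY by blast
  have "y \<noteq> c" "y \<in> S'" using XY y sides_disj sides_Un by blast+
  then have "y \<notin> S" using blocks_share_one[OF S S'(1) c(1) S'(2) _ _ not_sym] S'(3) z(1) by blast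
  moreover have "(c, y) \<in> D" using sides_adj XY y by blast
  ultimately have "gate S y c" "d y c = 1"
    using gate_adj[OF c(1)] by (simp_all add: d_eq_1 D_sym)
  with y(2) \<open>y \<notin> S\<close> show ?thesis by blast
qed

text \<open>The half of the equality of eccentricities that isometry does not give: passing from
  \<open>V\<close> to \<open>W\<close> loses no farthest vertex.\<close>

lemma far_in_W:
  assumes x: "x \<in> V" and w: "w \<in> V"
  shows "\<exists>y \<in> W. d x w \<le> d x y"
proof (cases "w \<in> W")
  case False
  then have "w \<notin> cuts" using cuts_W by blast
  obtain S where S: "block S" "w \<in> S" using w vertex_in_block by blast
  obtain X Y where XY: "sides S X Y" "w \<in> X" using S sides_at by blast
  obtain p where p: "gate S x p" using gate_ex S x by blast
  have "p \<in> S" "p \<in> V" using p gate_mem block_sub[OF S(1)] by blast+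
  have dw: "d x w = d x p + d p w" using d_gate S x p by blast
  show ?thesis
  proof (cases "\<exists>q \<in> S \<inter> cuts. q \<noteq> p")
    case True
    \<comment> \<open>Going from \<open>p\<close> to a second cut-vertex \<open>q\<close> and one
      step past it costs at least 1 + 1, which covers \<open>d p w\<close>, at most 2.\<close>
    then obtain q where q: "q \<in> S" "q \<in> cuts" "q \<noteq> p" by blast
    obtain y where y: "y \<in> W" "y \<notin> S" "gate S y q" "d y q = 1" using beyond_cut S q by blast
    have "y \<in> V" "q \<in> V" using y W_V q cuts_sub by blast+
    then have "d x y = d x p + d p q + d q y" using d_across S x p y q by blast
    moreover have "d q y = 1" using d_sym \<open>y \<in> V\<close> \<open>q \<in> V\<close> y by simp
    moreover have "d p q \<noteq> 0" using d_eq_0_iff \<open>p \<in> V\<close> \<open>q \<in> V\<close> q by blast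
    moreover have "d p w \<le> 2" using sides_d_le_2 XY \<open>p \<in> S\<close> S by blast
    ultimately have "d x w \<le> d x y" using dw by linarith
    with y show ?thesis by blast
  next
    case False
    then have only: "q = p" if "q \<in> S" "q \<in> cuts" for q using that by blast
    \<comment> \<open>Every block contains a cut-vertex, so \<open>p\<close> is the only one here
      and \<open>S\<close> is a leaf block. \<open>W_leaf\<close> then gives \<open>u\<close> in the
      side of \<open>w\<close>; neither of them is \<open>p\<close>, so both are equally far from
      \<open>p\<close>.\<close>
    obtain c where c: "c \<in> S" "c \<in> cuts" using block_has_cut[OF S(1)] by blast
    then have "c = p" by (rule only)
    with c only have Sp: "S \<inter> cuts = {p}" by blast
    then obtain u where u: "u \<in> X" "u \<notin> cuts" "u \<in> W"
      using W_leaf[OF XY(1)] XY(2) \<open>w \<notin> cuts\<close> by auto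
    have "u \<noteq> p" "w \<noteq> p" "u \<in> S" using Sp u \<open>w \<notin> cuts\<close> XY sides_Un by blast+
    have "d p u = d p w"
    proof (cases "p \<in> X")
      case True
      then show ?thesis using sides_d_same XY u \<open>u \<noteq> p\<close> \<open>w \<noteq> p\<close> by metis
    next
      case False
      then have "p \<in> Y" using XY sides_Un \<open>p \<in> S\<close> by blast
      then show ?thesis using sides_d_opposite sides_sym XY u by metis
    qed
    moreover have "d x u = d x p + d p u" using d_gate S x p \<open>u \<in> S\<close> by blast
    ultimately have "d x w \<le> d x u" using dw by simp
    with u show ?thesis by blast
  qed
qed auto

text \<open>The vertex \<open>t\<close> is the one cut-vertex in \<open>Y\<close> if there is any.
  An outer vertex enters \<open>S\<close> at some cut-vertex \<open>p\<close>: for \<open>p\<close>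
  in \<open>X\<close> the distances to \<open>w\<close> and \<open>t\<close> are 2 and 1, for
  \<open>p\<close> in \<open>Y\<close> they are 1 and 0.\<close>

lemma W_closer_than_side_of_cut:
  assumes XY: "sides S X Y" and w: "w \<in> X" "w \<notin> cuts" and c: "c \<in> X" "c \<in> cuts"
  shows "\<exists>t \<in> W. e t < e w"
proof -
  have S: "block S" using XY sides_block by blast
  obtain t where t: "t \<in> Y" "t \<in> W" "\<And>q. q \<in> Y \<Longrightarrow> q \<in> cuts \<Longrightarrow> q = t"
  proof (cases "\<exists>q. q \<in> Y \<and> q \<in> cuts")
    case True
    then obtain t where t: "t \<in> Y" "t \<in> cuts" by blast
    have "q = t" if q: "q \<in> Y" "q \<in> cuts" for q
    proof (rule ccontr)
      assume "q \<noteq> t"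
      moreover have "c \<noteq> q" "c \<noteq> t" using sides_disj XY q t c by blast+
      ultimately have "card {c, q, t} = 3" by simp
      moreover have "finite (S \<inter> cuts)" using cuts_sub fin finite_subset by blast
      moreover have "{c, q, t} \<subseteq> S \<inter> cuts" using q t c XY sides_Un by blast
      ultimately have "3 \<le> card (S \<inter> cuts)" by (metis card_mono)
      with two_cuts[OF S] show False by linarith
    qed
    with t show thesis using that cuts_W by blast
  next
    case False
    with W_side[OF sides_sym[OF XY]] show thesis using that by blast
  qed
  have tV: "t \<in> V" "w \<in> V" "t \<in> S" "w \<in> S" "c \<in> S" "c \<in> V"
    using t W_V w c XY sides_Un sides_V by blast+
  \<comment> \<open>A vertex just past \<open>c\<close> is at distance 1 + 2 from \<open>w\<close>,
    while \<open>t\<close> is within 2 of all of \<open>S\<close>; so only vertices outside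
    \<open>S\<close> need the gate argument.\<close>
  obtain z where z: "z \<in> W" "z \<notin> S" "gate S z c" "d z c = 1"
    using beyond_cut S tV c by blast
  have zV: "z \<in> V" using z W_V by blast
  have "d z w = d z c + d c w" using d_gate S z zV tV by blast
  moreover have "d c w = 2" using sides_d_same XY c w by blast
  moreover have "d z w = d w z" using d_sym zV tV by blast
  ultimately have ew: "3 \<le> e w" using z(4) eccr_ge[OF fin zV, of D w] by linarith
  have "d t y < e w" if y: "y \<in> V" for y
  proof (cases "y \<in> S")
    case True
    then have "d t y \<le> 2" using sides_d_le_2 XY tV by blast
    with ew show ?thesis by linarith
  next
    case False
    obtain p where p: "gate S y p" using gate_ex S y by blast
    have p_cut: "p \<in> cuts" "p \<in> S" "p \<noteq> w" using gate_cut S p False gate_mem w by blast+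
    have "d p t < d p w"
    proof (cases "p \<in> X")
      case True
      then have "d p w = 2" "d p t = 1"
        using sides_d_same sides_d_opposite XY w p_cut t by blast+
      then show ?thesis by simp
    next
      case False
      then have "p \<in> Y" using p_cut XY sides_Un by blast
      then have "p = t" "d p w = 1"
        using t(3) p_cut sides_d_opposite[OF sides_sym[OF XY]] w by blast+
      then show ?thesis by simp
    qed
    moreover have "d y t = d y p + d p t" "d y w = d y p + d p w"
      using d_gate S y p tV by blast+
    moreover have "d y t = d t y" "d y w = d w y" using d_sym tV y by blast+
    ultimately show ?thesis using eccr_ge[OF fin y, of D w] by linarith
  qed
  then have "e t < e w" using eccr_attained[OF fin nonempty, of D t] by auto
  with t show ?thesis by blast
qed

text \<open>All entrances to \<open>S\<close> lie in \<open>Y\<close>, at distance 1 from both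
  \<open>w\<close> and \<open>w'\<close>, so distances to outer vertices agree. Inside
  \<open>S\<close> distances are at most 2, and a vertex just past a cut-vertex is already that far
  from \<open>w'\<close>.\<close>

lemma side_without_cut_le:
  assumes XY: "sides S X Y" and X: "X \<inter> cuts = {}" and w: "w \<in> X" "w' \<in> X"
  shows "e w \<le> e w'"
proof -
  have S: "block S" using XY sides_block by blast
  obtain c where c: "c \<in> S" "c \<in> cuts" using block_has_cut S by blast
  then have "c \<in> Y" using X XY sides_Un by blast
  obtain z where z: "z \<in> W" "z \<notin> S" "gate S z c" "d z c = 1"
    using beyond_cut S c by blast
  have V: "z \<in> V" "w \<in> V" "w' \<in> V" "w \<in> S" "w' \<in> S"
    using z W_V w XY sides_V sides_Un by blast+
  have "d z w' = d z c + d c w'" using d_gate S z V by blast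
  moreover have "d c w' = 1" using sides_d_opposite sides_sym XY w \<open>c \<in> Y\<close> by blast
  moreover have "d z w' = d w' z" using d_sym V by blast
  ultimately have ew: "2 \<le> e w'" using z(4) eccr_ge[OF fin V(1), of D w'] by linarith
  have "d w y \<le> e w'" if y: "y \<in> V" for y
  proof (cases "y \<in> S")
    case True
    then have "d w y \<le> 2" using sides_d_le_2 XY V by blast
    with ew show ?thesis by linarith
  next
    case False
    obtain p where p: "gate S y p" using gate_ex S y by blast
    have "p \<in> cuts" "p \<in> S" using gate_cut S p False gate_mem by blast+
    then have "p \<in> Y" using X XY sides_Un by blast
    then have "d p w = 1" "d p w' = 1" using sides_d_opposite sides_sym XY w by blast+
    moreover have "d y w = d y p + d p w" "d y w' = d y p + d p w'"
      using d_gate S y p V by blast+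
    moreover have "d y w = d w y" "d y w' = d w' y" using d_sym V y by blast+
    ultimately show ?thesis using eccr_ge[OF fin y, of D w'] by linarith
  qed
  then show ?thesis using eccr_attained[OF fin nonempty, of D w] by auto
qed

lemma side_without_cut_eq:
  "sides S X Y \<Longrightarrow> X \<inter> cuts = {} \<Longrightarrow> w \<in> X \<Longrightarrow> w' \<in> X \<Longrightarrow> e w = e w'"
  by (rule antisym; rule side_without_cut_le)

section \<open>Retraction onto \<open>W\<close> and equality of eccentricities\<close>

lemma retract_ex:
  assumes w: "w \<in> V"
  shows "\<exists>t \<in> W. (w \<in> W \<longrightarrow> t = w) \<and> (\<forall>S X Y. sides S X Y \<longrightarrow> w \<in> X \<longrightarrow> t \<in> X)"
proof (cases "w \<in> W")
  case False
  then have "w \<notin> cuts" using cuts_W by blast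
  obtain S where S: "block S" "w \<in> S" using w vertex_in_block by blast
  obtain X Y where XY: "sides S X Y" "w \<in> X" using S sides_at by blast
  obtain t where t: "t \<in> X" "t \<in> W" using W_side XY by blast
  \<comment> \<open>A non-cut-vertex lies in one block only, so the choice made in this block meets
    the condition for all blocks.\<close>
  have "t \<in> X'" if "sides S' X' Y'" "w \<in> X'" for S' X' Y'
  proof -
    have "S' = S" using noncut_block_unique S \<open>w \<notin> cuts\<close> that sides_block sides_Un by blast
    then show ?thesis using sides_unique XY that t by blast
  qed
  with t False show ?thesis by blast
qed auto

lemma W_isometric:
  assumes xy: "x \<in> W" "y \<in> W"
  shows "dst (rel_on D W) x y = d x y"
proof (rule antisym)
  obtain r where r: "\<And>w. w \<in> V \<Longrightarrow> r w \<in> W" "\<And>w. w \<in> V \<Longrightarrow> w \<in> W \<Longrightarrow> r w = w"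
    "\<And>w S X Y. w \<in> V \<Longrightarrow> sides S X Y \<Longrightarrow> w \<in> X \<Longrightarrow> r w \<in> X"
    using bchoice[of V] retract_ex by (metis (lifting))
  \<comment> \<open>The ends of an arc lie in opposite sides of one block, their images stay in
    these sides, and opposite sides are completely joined.\<close>
  have hom: "(r u, r v) \<in> rel_on D W" if uv: "(u, v) \<in> D" for u v
  proof -
    have V: "u \<in> V" "v \<in> V" using D_V uv by blast+
    obtain S where S: "block S" "u \<in> S" "v \<in> S" using edge_in_block uv by blast
    obtain X Y where XY: "sides S X Y" "u \<in> X" using S sides_at by blast
    then have "v \<in> Y" using sides_adjD S uv by blast
    then have "r u \<in> X" "r v \<in> Y" using r(3) V XY sides_sym by blast+
    then show ?thesis using sides_adj XY r(1) V by blast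
  qed
  have walk: "(r u, r v) \<in> rel_on D W ^^ n" if "(u, v) \<in> D ^^ n" for u v n
    using that
  proof (induction n arbitrary: v)
    case (Suc n)
    then obtain z where "(u, z) \<in> D ^^ n" "(z, v) \<in> D" by auto
    then show ?case using Suc.IH hom by (blast intro: relpow_Suc_I)
  qed auto
  have V: "x \<in> V" "y \<in> V" using xy W_V by blast+
  have T: "(x, y) \<in> rel_on D W ^^ d x y"
    using walk[OF d_walk[OF V]] r(2) V xy by simp
  then show "dst (rel_on D W) x y \<le> d x y" by (rule dst_le)
  have "(x, y) \<in> rel_on D W ^^ dst (rel_on D W) x y"
    using T by (intro dst_walk relpow_imp_rtrancl)
  moreover have "rel_on D W ^^ n \<subseteq> D ^^ n" for n
    by (induction n) auto
  ultimately show "d x y \<le> dst (rel_on D W) x y" by (blast intro: dst_le)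
qed

lemma W_nonempty: "W \<noteq> {}"
  using nonempty retract_ex by blast

lemma finite_W: "finite W"
  using W_V fin finite_subset by blast

lemma W_ecc:
  assumes x: "x \<in> W" shows "eccr W (rel_on D W) x = e x"
proof (rule antisym)
  obtain v where "v \<in> W" "eccr W (rel_on D W) x = dst (rel_on D W) x v"
    using eccr_attained[OF finite_W W_nonempty] by blast
  then show "eccr W (rel_on D W) x \<le> e x"
    using W_isometric x eccr_ge[OF fin] W_V by (metis subsetD)
  obtain w where w: "w \<in> V" "e x = d x w" using eccr_attained[OF fin nonempty] by blast
  obtain y where y: "y \<in> W" "d x w \<le> d x y" using far_in_W w x W_V by blast
  then have "d x w \<le> dst (rel_on D W) x y" using W_isometric x by simp
  then show "e x \<le> eccr W (rel_on D W) x"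
    using w(2) eccr_ge[OF finite_W y(1), of "rel_on D W" x] by linarith
qed

section \<open>Comparison of the two centres\<close>

lemma noncut_cases:
  assumes "w \<in> V" "w \<notin> cuts"
  obtains (closer) t where "t \<in> W" "e t < e w"
  | (twins) S X Y where "sides S X Y" "w \<in> X" "X \<inter> cuts = {}"
proof -
  obtain S where S: "block S" "w \<in> S" using assms vertex_in_block by blast
  obtain X Y where XY: "sides S X Y" "w \<in> X" using S sides_at by blast
  show thesis
  proof (cases "X \<inter> cuts = {}")
    case True
    with XY show thesis by (rule twins)
  next
    case False
    then obtain c where "c \<in> X" "c \<in> cuts" by blast
    then show thesis using W_closer_than_side_of_cut[OF XY assms(2)] closer by blast
  qed
qed

text \<open>Minimality over \<open>W\<close> implies minimality over \<open>V\<close>: a vertex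
  outside \<open>W\<close> is beaten by one of \<open>W\<close>, or shares its eccentricity with a
  vertex of \<open>W\<close> in its own side.\<close>

lemma centre_W: "centre W (rel_on D W) = centre V D \<inter> W"
proof -
  have "e u \<le> e v" if u: "\<forall>t \<in> W. e u \<le> e t" and v: "v \<in> V" for u v
  proof (cases "v \<in> W")
    case False
    then have "v \<notin> cuts" using cuts_W by blast
    with v show ?thesis
    proof (cases rule: noncut_cases)
      case (closer t)
      then show ?thesis using u by fastforce
    next
      case (twins S X Y)
      obtain t where "t \<in> X" "t \<in> W" using W_side twins by blast
      then show ?thesis using u side_without_cut_eq twins by metis
    qed
  qed (use u in blast)
  then show ?thesis
    using W_V by (auto simp: centre_def W_ecc subset_iff)
qed

text \<open>A cut-vertex in \<open>X\<close> would yield a vertex strictly less eccentric than the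
  central \<open>z\<close>. So \<open>X\<close> has none, and its vertices are equally
  eccentric.\<close>

lemma centre_noncut:
  assumes XY: "sides S X Y" and z: "z \<in> X" "z \<notin> cuts" "z \<in> centre V D"
  shows "X \<subseteq> centre V D"
proof -
  have "X \<inter> cuts = {}"
  proof (rule ccontr)
    assume "X \<inter> cuts \<noteq> {}"
    then obtain t where "t \<in> W" "e t < e z" using W_closer_than_side_of_cut XY z by blast
    with z show False using W_V unfolding centre_def by fastforce
  qed
  then have "e x = e z" if "x \<in> X" for x using side_without_cut_eq XY z that by blast
  moreover have "X \<subseteq> V" using sides_V[OF XY] sides_Un[OF XY] by blast
  ultimately show ?thesis using z(3) unfolding centre_def by auto
qed

lemma centre_outside_W:
  assumes w: "w \<in> centre V D" "w \<notin> W"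
  shows "\<exists>S X Y z. sides S X Y \<and> w \<in> X \<and> z \<in> X \<and> z \<notin> cuts \<and> z \<in> centre W (rel_on D W)"
proof -
  have wV: "w \<in> V" "w \<notin> cuts" using w cuts_W unfolding centre_def by blast+
  then show ?thesis
  proof (cases rule: noncut_cases)
    case (closer t)
    then show ?thesis using w W_V unfolding centre_def by fastforce
  next
    case (twins S X Y)
    obtain t where t: "t \<in> X" "t \<in> W" using W_side twins by blast
    then have "t \<in> centre W (rel_on D W)"
      using centre_noncut[OF twins(1,2) wV(2) w(1)] centre_W by blast
    with twins t show ?thesis by blast
  qed
qed

lemma mem_centre_iff:
  "w \<in> centre V D \<longleftrightarrow> w \<in> centre W (rel_on D W) \<or>
     (\<exists>S X Y z. sides S X Y \<and> w \<in> X \<and> z \<in> X \<and> z \<notin> cuts \<and> z \<in> centre W (rel_on D W))"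
  (is "?L \<longleftrightarrow> ?R1 \<or> ?R2")
proof
  assume ?L
  then show "?R1 \<or> ?R2" using centre_outside_W centre_W by (cases "w \<in> W") auto
next
  assume "?R1 \<or> ?R2"
  then show ?L
  proof
    assume ?R1
    then show ?L using centre_W by blast
  next
    assume ?R2
    then obtain S X Y z where *: "sides S X Y" "w \<in> X" "z \<in> X" "z \<notin> cuts"
      "z \<in> centre W (rel_on D W)" by (elim exE conjE)
    then have "z \<in> centre V D" using centre_W by simp
    with * show ?L using centre_noncut by (meson subsetD)
  qed
qed

lemma noncut_side_unique:
  assumes "sides S X Y" "sides S' X' Y'" "z \<in> X" "z \<in> X'" "z \<notin> cuts"
  shows "X' = X"
proof -
  have "S' = S" using assms noncut_block_unique sides_block sides_Un by blast
  with assms show ?thesis using sides_unique by blast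
qed

lemma centre_all_cuts:
  assumes "centre W (rel_on D W) \<subseteq> cuts"
  shows "centre V D = centre W (rel_on D W)"
  using assms by (auto simp: mem_centre_iff)

text \<open>The side of \<open>z\<close> is the same whichever block is used, so the existential
  part of \<open>mem_centre_iff\<close> collapses to membership in \<open>X\<close>.\<close>

lemma centre_one_noncut:
  assumes z: "centre W (rel_on D W) - cuts = {z}" and XY: "sides S X Y" "z \<in> X"
  shows "centre V D = (centre W (rel_on D W) \<inter> cuts) \<union> X"
proof -
  have z': "u \<notin> cuts \<and> u \<in> centre W (rel_on D W) \<longleftrightarrow> u = z" for u
    using eqset_imp_iff[OF z, of u] by simp blast
  have unique: "X' = X" if "sides S' X' Y'" "z \<in> X'" for S' X' Y'
    by (rule noncut_side_unique[OF XY(1) that(1) XY(2) that(2)]) (use z' in blast)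
  have side: "(\<exists>S' X' Y' u. sides S' X' Y' \<and> w \<in> X' \<and> u \<in> X' \<and> u = z) \<longleftrightarrow> w \<in> X" for w
  proof (intro iffI; (elim exE conjE)?)
    fix S' X' Y' u assume *: "sides S' X' Y'" "w \<in> X'" "u \<in> X'" "u = z"
    then have "X' = X" by (intro unique) simp_all
    with *(2) show "w \<in> X" by simp
  next
    assume "w \<in> X"
    with XY show "\<exists>S' X' Y' u. sides S' X' Y' \<and> w \<in> X' \<and> u \<in> X' \<and> u = z" by blast
  qed
  have centre: "w \<in> centre V D \<longleftrightarrow> w \<in> centre W (rel_on D W) \<or> w \<in> X" for w
    unfolding mem_centre_iff z' side ..
  show ?thesis
  proof (rule set_eqI)
    fix w
    show "w \<in> centre V D \<longleftrightarrow> w \<in> (centre W (rel_on D W) \<inter> cuts) \<union> X"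
      using centre[of w] z'[of w] XY(2) by (cases "w \<in> cuts") auto
  qed
qed

end

section \<open>From digraphs to relations\<close>

text \<open>Meant for \<open>P\<close> the lengths of paths and \<open>Q\<close> the lengths of
  walks.\<close>

lemma Least_eqI_bounded:
  fixes P Q :: "nat \<Rightarrow> bool"
  assumes PQ: "\<And>n. P n \<Longrightarrow> Q n" and QP: "\<And>n. Q n \<Longrightarrow> \<exists>m\<le>n. P m"
  shows "(LEAST n. P n) = (LEAST n. Q n)"
proof (cases "\<exists>n. Q n")
  case True
  then have Q: "Q (LEAST n. Q n)" by (rule LeastI_ex)
  then obtain m where m: "m \<le> (LEAST n. Q n)" "P m" using QP by blast
  then have "(LEAST n. P n) \<le> (LEAST n. Q n)" by (meson Least_le le_trans)
  moreover have "Q (LEAST n. P n)" using m(2) by (intro PQ LeastI)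
  then have "(LEAST n. Q n) \<le> (LEAST n. P n)" by (rule Least_le)
  ultimately show ?thesis by simp
next
  case False
  \<comment> \<open>Without any walk the two predicates coincide, and so do the unspecified values
    of \<open>LEAST\<close>.\<close>
  then have "P = (\<lambda>_. False)" "Q = (\<lambda>_. False)" using PQ by auto
  then show ?thesis by simp
qed

context wf_digraph
begin

lemma awalk_imp_relpow: "awalk u p v \<Longrightarrow> (u, v) \<in> arcs_ends G ^^ length p"
proof (induction p arbitrary: u)
  case (Cons a p)
  then have "(u, head G a) \<in> arcs_ends G" "(head G a, v) \<in> arcs_ends G ^^ length p"
    by (auto simp: awalk_Cons_iff in_arcs_imp_in_arcs_ends)
  then have "(u, v) \<in> arcs_ends G ^^ Suc (length p)" by (rule relpow_Suc_I2)
  then show ?case by (simp del: relpow.simps)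
qed (auto simp: awalk_Nil_iff)

lemma relpow_imp_awalk:
  "u \<in> verts G \<Longrightarrow> (u, v) \<in> arcs_ends G ^^ n \<Longrightarrow> \<exists>p. awalk u p v \<and> length p = n"
proof (induction n arbitrary: u)
  case 0
  then show ?case by (auto simp: awalk_Nil_iff)
next
  case (Suc n)
  then obtain w where w: "(u, w) \<in> arcs_ends G" "(w, v) \<in> arcs_ends G ^^ n"
    by (blast dest: relpow_Suc_D2)
  then obtain a where a: "a \<in> arcs G" "tail G a = u" "head G a = w" by blast
  obtain p where "awalk w p v" "length p = n" using Suc.IH[OF _ w(2)] a by auto
  with a show ?case by (intro exI[of _ "a # p"]) (auto simp: awalk_Cons_iff)
qed

lemma gdist_eq_dst:
  assumes u: "u \<in> verts G"
  shows "gdist G u v = dst (arcs_ends G) u v"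
  unfolding gdist_def dst_def
proof (rule Least_eqI_bounded)
  fix n assume "\<exists>p. apath u p v \<and> length p = n"
  then show "(u, v) \<in> arcs_ends G ^^ n" using awalk_imp_relpow awalkI_apath by blast
next
  fix n assume "(u, v) \<in> arcs_ends G ^^ n"
  then obtain p where p: "awalk u p v" "length p = n" using relpow_imp_awalk u by blast
  have path: "apath u (awalk_to_apath p) v" using p(1) by (rule apath_awalk_to_apath)
  then have "distinct (awalk_to_apath p)"
    using distinct_verts_imp_distinct unfolding apath_def by blast
  \<comment> \<open>The path is a list of distinct arcs, all of them occurring in
    \<open>p\<close>.\<close>
  then have "length (awalk_to_apath p) \<le> length p"
    using awalk_to_apath_subset[OF p(1)]
    by (metis List.finite_set card_length card_mono distinct_card le_trans)
  with path p show "\<exists>m\<le>n. \<exists>p. apath u p v \<and> length p = m" by blast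
qed

lemma gcenter_eq_centre:
  assumes "finite (verts G)" "verts G \<noteq> {}"
  shows "gcenter G = centre (verts G) (arcs_ends G)"
proof -
  let ?V = "verts G" and ?e = "eccr (verts G) (arcs_ends G)"
  have ecc: "ecc G u = ?e u" if "u \<in> ?V" for u
    unfolding ecc_def eccr_def using that by (simp add: gdist_eq_dst)
  have "rad G = Min (?e ` ?V)"
    unfolding rad_def Setcompr_eq_image by (simp add: ecc cong: image_cong_simp)
  then have "?e u = rad G \<longleftrightarrow> (\<forall>v \<in> ?V. ?e u \<le> ?e v)" if "u \<in> ?V" for u
    using assms that eq_Min_iff[of "?e ` ?V" "?e u"] by auto
  then show ?thesis unfolding gcenter_def centre_def by (auto simp: ecc)
qed

lemma arcs_ends_induce: "arcs_ends (G \<restriction> S) = rel_on (arcs_ends G) S"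
  by (auto simp: arcs_ends_conv)

lemma arcs_ends_del_vert: "arcs_ends (del_vert v) = rel_on (arcs_ends G) (verts G - {v})"
  by (auto simp: arcs_ends_conv del_vert_simps)

lemma arcs_ends_subset_verts: "arcs_ends G \<subseteq> verts G \<times> verts G"
  by (auto dest: adj_in_verts)

text \<open>Reachability requires its start to be a vertex, whereas the closure is reflexive
  everywhere; hence the assumption on \<open>u\<close>.\<close>

lemma reachable_del_vert:
  assumes "u \<in> verts G - {v}"
  shows "u \<rightarrow>\<^sup>*\<^bsub>del_vert v\<^esub> w \<longleftrightarrow> (u, w) \<in> (rel_on (arcs_ends G) (verts G - {v}))\<^sup>*"
  using wf_digraph.reachable_conv'[OF wf_digraph_del_vert, of u v w] assms
  by (simp add: verts_del_vert arcs_ends_del_vert)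

end

text \<open>Blocks are maximal among all subgraphs, induced or not; this allows missing arcs to be
  added.\<close>

lemma nonsep_mono:
  assumes "D \<subseteq> D'" "nonsep D S" shows "nonsep D' S"
proof -
  have "(rel_on D A)\<^sup>* \<subseteq> (rel_on D' A)\<^sup>*" for A using assms(1) by (intro rtrancl_mono) auto
  with assms(2) show ?thesis unfolding nonsep_def by blast
qed

lemma nonsep_rel_on: "nonsep (rel_on D S) S \<longleftrightarrow> nonsep D S"
proof -
  have "rel_on (rel_on D S) (S - Z) = rel_on D (S - Z)" for Z by auto
  then show ?thesis unfolding nonsep_def by simp
qed

context sym_digraph
begin

lemma connected_iff:
  "connected G \<longleftrightarrow> verts G \<noteq> {} \<and> (\<forall>u \<in> verts G. \<forall>v \<in> verts G. (u, v) \<in> (arcs_ends G)\<^sup>*)"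
  (is "_ \<longleftrightarrow> ?R")
proof
  assume "connected G"
  with sym_arcs have "strongly_connected G" by (rule symmetric_connected_imp_strongly_connected)
  then show ?R unfolding strongly_connected_def by (auto dest: reachable_rtranclI)
next
  assume ?R
  then show "connected G"
    by (intro connectedI reachable_mk_symmetricI) (auto simp: reachable_conv')
qed

lemma nonsep_iff:
  "connected G \<and> (\<forall>v. \<not> cut_vertex G v) \<longleftrightarrow> nonsep (arcs_ends G) (verts G)" (is "?L \<longleftrightarrow> ?R")
proof
  let ?V = "verts G" and ?D = "arcs_ends G"
  have VD: "rel_on ?D ?V = ?D" using arcs_ends_subset_verts by auto
  {
    assume ?L
    then have *: "?V \<noteq> {}" "\<And>u v. u \<in> ?V \<Longrightarrow> v \<in> ?V \<Longrightarrow> (u, v) \<in> ?D\<^sup>*"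
      and nc: "\<And>v. \<not> cut_vertex G v"
      unfolding connected_iff by auto
    have "(a, b) \<in> (rel_on ?D (?V - Z))\<^sup>*"
      if Z: "Z \<subseteq> {v}" "a \<in> ?V - Z" "b \<in> ?V - Z" for Z v a b
    \<comment> \<open>Deleting an actual vertex is the cut-vertex condition; in the other case
      nothing is removed and connectedness answers.\<close>
    proof (cases "Z = {v} \<and> v \<in> ?V")
      case True
      with Z * nc[of v] show ?thesis
        unfolding cut_vertex_def by (auto simp: reachable_del_vert reachable_conv')
    next
      case False
      then have "?V - Z = ?V" using Z by auto
      then show ?thesis using VD * Z by auto
    qed
    with *(1) show ?R unfolding nonsep_def by blast
  next
    assume R: ?R
    have "(u, v) \<in> ?D\<^sup>*" if "u \<in> ?V" "v \<in> ?V" for u v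
      using nonsepD[OF R, of "{}" undefined u v] that VD by simp
    moreover have "?V \<noteq> {}" using R unfolding nonsep_def by blast
    ultimately have "connected G" unfolding connected_iff by blast
    moreover have "\<not> cut_vertex G v" for v
      using nonsepD[OF R, of "{v}" v] unfolding cut_vertex_def
      by (auto simp: reachable_del_vert)
    ultimately show ?L by blast
  }
qed

end

section \<open>Blocks and bipartitions of a connected graph\<close>

locale conn_graph = graph +
  assumes connected: "connected G"
begin

sublocale rel: conn_rel "verts G" "arcs_ends G"
proof
  show "finite (verts G)" by simp
  show "arcs_ends G \<subseteq> verts G \<times> verts G" by (rule arcs_ends_subset_verts)
  show "sym (arcs_ends G)" using sym_arcs unfolding symmetric_def .
  show "irrefl (arcs_ends G)" using adj_not_same by (auto simp: irrefl_def)
qed (use connected connected_iff in auto)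

lemma cut_vertices_eq: "cut_vertices G = rel.cuts"
  unfolding cut_vertices_def rel.cuts_def cut_vertex_def
  using rel.conn by (auto simp: reachable_del_vert reachable_conv')

lemma graph_induce:
  assumes "S \<subseteq> verts G" shows "graph (G \<restriction> S)"
proof -
  have ind: "induced_subgraph (G \<restriction> S) G" using assms by (rule induced_induce)
  interpret H: digraph "G \<restriction> S" using ind by (rule digraphI_induced)
  show ?thesis using induced_graph_imp_symmetric[OF sym_arcs ind] by (rule H.graphI)
qed

lemma nonseparable_induce_iff:
  assumes "S \<subseteq> verts G"
  shows "nonseparable_subgraph (G \<restriction> S) G \<longleftrightarrow> nonsep (arcs_ends G) S"
proof -
  interpret H: graph "G \<restriction> S" using assms by (rule graph_induce)
  have "subgraph (G \<restriction> S) G" using assms by (rule subgraph_induce_subgraphI)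
  then show ?thesis
    unfolding nonseparable_subgraph_def
    using H.nonsep_iff H.graph_axioms by (simp add: arcs_ends_induce nonsep_rel_on)
qed

lemma nonseparable_imp_nonsep:
  assumes "nonseparable_subgraph H G"
  shows "nonsep (arcs_ends G) (verts H)"
proof -
  interpret H: graph H using assms unfolding nonseparable_subgraph_def by blast
  have "nonsep (arcs_ends H) (verts H)"
    using assms H.nonsep_iff unfolding nonseparable_subgraph_def by blast
  moreover have "arcs_ends H \<subseteq> arcs_ends G"
    using assms arcs_ends_mono unfolding nonseparable_subgraph_def by blast
  ultimately show ?thesis using nonsep_mono by blast
qed

lemma subgraph_of_induce:
  assumes "subgraph H G" "verts H \<subseteq> S" shows "subgraph H (G \<restriction> S)"
proof -
  interpret H: wf_digraph H using assms(1) by auto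
  have "tail H = tail G" "head H = head G" "arcs H \<subseteq> arcs G"
    using assms(1) by (auto simp: subgraph_def compatible_def)
  moreover have "tail H a \<in> S" "head H a \<in> S" if "a \<in> arcs H" for a
    using that assms(2) by auto
  ultimately show ?thesis
    using assms(2) H.wf_digraph by (auto simp: subgraph_def compatible_def)
qed

lemma subgraph_antisym: "subgraph H K \<Longrightarrow> subgraph K H \<Longrightarrow> H = K"
  by (rule pre_digraph.equality) (auto simp: subgraph_def compatible_def)

text \<open>For a block \<open>B\<close>, the induced subgraph on any nonseparable superset of
  \<open>verts B\<close> is a nonseparable subgraph above \<open>B\<close>, hence equal to
  \<open>B\<close>. The superset \<open>verts B\<close> itself shows that \<open>B\<close> is
  induced, and larger ones show that its vertex set is maximal.\<close>

lemma blocks_eq: "blocks G = {G \<restriction> S | S. rel.block S}"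
proof (intro equalityI subsetI)
  fix B assume "B \<in> blocks G"
  then have B: "nonseparable_subgraph B G"
    and max: "\<And>H. nonseparable_subgraph H G \<Longrightarrow> subgraph B H \<Longrightarrow> H = B"
    unfolding blocks_def by auto
  have sub: "subgraph B G" using B unfolding nonseparable_subgraph_def by blast
  then have V: "verts B \<subseteq> verts G" by blast
  have eq: "G \<restriction> S = B" if "verts B \<subseteq> S" "S \<subseteq> verts G" "nonsep (arcs_ends G) S" for S
    using that nonseparable_induce_iff sub by (intro max subgraph_of_induce) auto
  have ns: "nonsep (arcs_ends G) (verts B)" using B by (rule nonseparable_imp_nonsep)
  have "rel.block (verts B)"
    unfolding rel.block_def using ns V eq by (metis induce_subgraph_verts)
  moreover have "B = G \<restriction> verts B" using eq ns V by simp
  ultimately show "B \<in> {G \<restriction> S | S. rel.block S}" by blast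
next
  fix B assume "B \<in> {G \<restriction> S | S. rel.block S}"
  then obtain S where S: "B = G \<restriction> S" "rel.block S" by blast
  have "nonseparable_subgraph B G"
    using S nonseparable_induce_iff rel.block_sub rel.block_nonsep by blast
  moreover have "H = B" if H: "nonseparable_subgraph H G" "subgraph B H" for H
  proof -
    have sub: "subgraph H G" using H unfolding nonseparable_subgraph_def by blast
    have "S \<subseteq> verts H" using H(2) S(1) by (auto simp: subgraph_def)
    moreover have "verts H \<subseteq> verts G" using sub by blast
    ultimately have "verts H = S"
      using rel.block_max[OF S(2)] nonseparable_imp_nonsep H(1) by blast
    then have "subgraph H B" unfolding S(1) using sub by (intro subgraph_of_induce) auto
    then show ?thesis using H(2) by (rule subgraph_antisym)
  qed
  ultimately show "B \<in> blocks G" unfolding blocks_def by blast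
qed

text \<open>Identifies the assigned partite sets with those of the complete bipartite structure, up
  to a swap. Complete adjacency puts \<open>W\<close> opposite to \<open>u\<close>, and then
  \<open>U\<close> opposite to \<open>w\<close>.\<close>

lemma sides_of_bipartition:
  assumes S: "rel.sides S U W" and XY: "bipartition (G \<restriction> S) X Y"
  shows "rel.sides S X Y"
proof -
  have UW: "S = U \<union> W" "U \<inter> W = {}" "U \<noteq> {}" "W \<noteq> {}" "rel_on (arcs_ends G) S = U \<times> W \<union> W \<times> U"
    using S unfolding rel.sides_def by auto
  have XY': "S = X \<union> Y" "X \<inter> Y = {}" "rel_on (arcs_ends G) S \<subseteq> X \<times> Y \<union> Y \<times> X"
    using XY unfolding bipartition_def arcs_ends_induce induce_subgraph_verts by blast+
  then have xy: "S = X \<union> Y" "X \<inter> Y = {}" "U \<times> W \<subseteq> X \<times> Y \<union> Y \<times> X"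
    unfolding UW(5) by simp_all
  \<comment> \<open>Two partitions of one set, one contained piecewise in the other, are
    equal.\<close>
  have eq: "A = C \<and> B = E"
    if "A \<union> B = C \<union> E" "A \<inter> B = {}" "C \<subseteq> A" "E \<subseteq> B" for A B C E :: "'a set"
    using that by auto
  obtain u where u: "u \<in> U" using UW by blast
  obtain w where w: "w \<in> W" using UW by blast
  have un: "X \<union> Y = U \<union> W" using UW(1) xy(1) by simp
  consider "u \<in> X" | "u \<in> Y" using u un by blast
  then have "X = U \<and> Y = W \<or> X = W \<and> Y = U"
  proof cases
    case 1
    have W: "W \<subseteq> Y" using u 1 xy(2,3) by blast
    moreover have "U \<subseteq> X" using w W xy(2,3) by blast
    ultimately show ?thesis using eq[OF un xy(2)] by blast
  next
    case 2
    have W: "W \<subseteq> X" using u 2 xy(2,3) by blast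
    moreover have "U \<subseteq> Y" using w W xy(2,3) by blast
    ultimately show ?thesis using eq[of X Y W U] un xy(2) by (simp add: Un_commute)
  qed
  then show ?thesis using S rel.sides_sym by blast
qed

end

lemma min_non_cut_nonempty:
  assumes "w \<in> X - cut_vertices G" shows "min_non_cut G lab X \<noteq> {}"
  using ex_has_least_nat[of "\<lambda>u. u \<in> X - cut_vertices G" w lab] assms
  unfolding min_non_cut_def by blast

lemma min_non_cut_subset: "min_non_cut G lab X \<subseteq> X - cut_vertices G"
  unfolding min_non_cut_def by auto

section \<open>The associated tree\<close>

locale class_B_graph = conn_graph G for G :: "('a, 'b) pre_digraph" +
  fixes lab :: "'a \<Rightarrow> nat" and V1 V2 :: "('a, 'b) pre_digraph \<Rightarrow> 'a set"
  assumes class_B: "class_B G"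
    and bip: "\<And>B. B \<in> blocks G \<Longrightarrow> bipartition B (V1 B) (V2 B)"
begin

definition tree_verts :: "'a set" where
  "tree_verts = (\<Union>B \<in> blocks G. NC G lab V1 V2 B) \<union> cut_vertices G"

lemma sides_V12:
  assumes "B \<in> blocks G" shows "rel.sides (verts B) (V1 B) (V2 B)"
proof -
  obtain S where S: "B = G \<restriction> S" "rel.block S" using assms blocks_eq by blast
  obtain m n where "m \<ge> 1" "n \<ge> 1" "complete_bipartite_digraph m n B"
    using class_B assms unfolding class_B_def bi_block_graph_def by blast
  then obtain U W where UW: "verts B = U \<union> W" "U \<inter> W = {}" "card U \<ge> 1" "card W \<ge> 1"
    "arcs_ends B = U \<times> W \<union> W \<times> U"
    unfolding complete_bipartite_digraph_def by blast
  moreover have "U \<noteq> {}" "W \<noteq> {}" using UW(3,4) by auto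
  ultimately have "rel.sides S U W"
    unfolding rel.sides_def using S by (simp add: arcs_ends_induce)
  then show ?thesis using sides_of_bipartition bip[OF assms] S by simp
qed

lemma block_B: "rel.block S \<Longrightarrow> G \<restriction> S \<in> blocks G"
  using blocks_eq by blast

text \<open>A block filling the graph would absorb every other block, whereas \<open>class_B\<close>
  provides two.\<close>

lemma block_proper: assumes "rel.block S" shows "S \<noteq> verts G"
proof
  assume S: "S = verts G"
  have "S' = S" if "rel.block S'" for S'
    using rel.block_max[OF that _ _ rel.block_nonsep[OF assms]] rel.block_sub[OF that] S by simp
  then have "blocks G \<subseteq> {G \<restriction> S}" using blocks_eq by auto
  then have "card (blocks G) \<le> card {G \<restriction> S}" by (rule card_mono[rotated]) simp
  with class_B show False unfolding class_B_def by simp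
qed

lemma two_cuts: "rel.block S \<Longrightarrow> card (S \<inter> rel.cuts) \<le> 2"
  using class_B block_B unfolding class_B_def cut_vertices_eq by fastforce

lemma block_has_cut: "rel.block S \<Longrightarrow> S \<inter> rel.cuts \<noteq> {}"
  using rel.sides_has_cut[OF sides_V12[OF block_B]] block_proper by auto

text \<open>\<open>NC\<close> asks for two cut-vertices in one side before it asks for a leaf. A
  leaf block has one cut-vertex in all, so it falls through to the leaf branch, or is caught by the
  first branch with the same value.\<close>

lemma NC_leaf:
  assumes B: "B \<in> blocks G" "leaf_block G B"
  shows "min_non_cut G lab (V1 B) \<union> min_non_cut G lab (V2 B) \<subseteq> NC G lab V1 V2 B"
proof -
  have *: "verts B = V1 B \<union> V2 B" "verts B \<subseteq> verts G"
    using sides_V12[OF B(1)] rel.sides_Un rel.block_sub rel.sides_block by blast+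
  have fin: "finite (verts B \<inter> cut_vertices G)"
    using *(2) finite_verts finite_subset by blast
  have "card (V1 B \<inter> cut_vertices G) \<le> card (verts B \<inter> cut_vertices G)"
    "card (V2 B \<inter> cut_vertices G) \<le> card (verts B \<inter> cut_vertices G)"
    using * by (intro card_mono[OF fin]; blast)+
  then show ?thesis using B(2) unfolding NC_def leaf_block_def by (auto simp: Let_def)
qed

text \<open>A non-leaf block has exactly two cut-vertices. If \<open>X\<close> has none, both lie in
  \<open>Y\<close>, which is when \<open>NC\<close> takes its vertex from \<open>X\<close>.\<close>

lemma NC_clean_side:
  assumes B: "B \<in> blocks G"
    and X: "X = V1 B \<and> Y = V2 B \<or> X = V2 B \<and> Y = V1 B" and clean: "X \<inter> cut_vertices G = {}"
  shows "min_non_cut G lab X \<subseteq> NC G lab V1 V2 B"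
proof (cases "leaf_block G B")
  case True
  then show ?thesis using NC_leaf[OF B] X by auto
next
  case False
  have sides: "rel.sides (verts B) (V1 B) (V2 B)" using B by (rule sides_V12)
  have S: "rel.block (verts B)" using sides by (rule rel.sides_block)
  have Y: "verts B \<inter> cut_vertices G = Y \<inter> cut_vertices G"
    using rel.sides_Un[OF sides] X clean by auto
  have "card (verts B \<inter> cut_vertices G) \<noteq> 1" using False unfolding leaf_block_def .
  moreover have "finite (verts B \<inter> cut_vertices G)"
    using rel.block_sub[OF S] finite_verts finite_subset by blast
  then have "card (verts B \<inter> cut_vertices G) \<noteq> 0"
    using block_has_cut[OF S] by (simp add: cut_vertices_eq)
  moreover have "card (verts B \<inter> cut_vertices G) \<le> 2"
    using two_cuts[OF S] by (simp add: cut_vertices_eq)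
  ultimately have "card (Y \<inter> cut_vertices G) = 2" unfolding Y by linarith
  then show ?thesis using X clean unfolding NC_def by (auto simp: Let_def)
qed

lemma sides_V12_cases:
  assumes "rel.sides S X Y"
  defines "B \<equiv> G \<restriction> S"
  shows "B \<in> blocks G" "X = V1 B \<and> Y = V2 B \<or> X = V2 B \<and> Y = V1 B"
proof -
  show B: "B \<in> blocks G" using assms block_B rel.sides_block by blast
  have *: "rel.sides S (V1 B) (V2 B)" using sides_V12[OF B] unfolding B_def by simp
  obtain x where x: "x \<in> X" using assms unfolding rel.sides_def by blast
  then have "x \<in> V1 B \<or> x \<in> V2 B" using rel.sides_Un[OF *] rel.sides_Un[OF assms(1)] by blast
  then show "X = V1 B \<and> Y = V2 B \<or> X = V2 B \<and> Y = V1 B"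
    using rel.sides_unique[OF assms(1) * x] rel.sides_unique[OF assms(1) rel.sides_sym[OF *] x]
    by blast
qed

lemma tree_verts_subset: "tree_verts \<subseteq> verts G"
proof -
  have "NC G lab V1 V2 B \<subseteq> verts G" if B: "B \<in> blocks G" for B
  proof -
    have "NC G lab V1 V2 B \<subseteq> V1 B \<union> V2 B"
      unfolding NC_def min_non_cut_def by (auto simp: Let_def)
    moreover have "V1 B \<union> V2 B = verts B" using rel.sides_Un[OF sides_V12[OF B]] by simp
    ultimately show ?thesis
      using rel.block_sub[OF rel.sides_block[OF sides_V12[OF B]]] by simp
  qed
  then show ?thesis
    using rel.cuts_sub unfolding tree_verts_def cut_vertices_eq by blast
qed

sublocale tree: bi_block_rel "verts G" "arcs_ends G" tree_verts
proof
  fix S assume S: "rel.block S"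
  show "\<exists>X Y. rel.sides S X Y" using sides_V12[OF block_B[OF S]] by auto
  show "card (S \<inter> rel.cuts) \<le> 2" using S by (rule two_cuts)
  show "S \<noteq> verts G" using S by (rule block_proper)
next
  show "rel.cuts \<subseteq> tree_verts" unfolding tree_verts_def cut_vertices_eq by blast
  show "tree_verts \<subseteq> verts G" by (rule tree_verts_subset)
next
  fix S X Y assume XY: "rel.sides S X Y"
  note B = sides_V12_cases[OF XY]
  obtain x where x: "x \<in> X" using XY unfolding rel.sides_def by blast
  show "X \<inter> tree_verts \<noteq> {}"
  \<comment> \<open>A side with a cut-vertex meets the tree there; from any other side
    \<open>NC\<close> keeps the vertex of least label.\<close>
  proof (cases "X \<inter> cut_vertices G = {}")
    case True
    then have "min_non_cut G lab X \<noteq> {}" using x by (intro min_non_cut_nonempty[of x]) blast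
    then obtain u where u: "u \<in> min_non_cut G lab X" by blast
    then have "u \<in> NC G lab V1 V2 (G \<restriction> S)" using NC_clean_side[OF B True] by blast
    then have "u \<in> tree_verts" using B(1) unfolding tree_verts_def by blast
    moreover have "u \<in> X" using u min_non_cut_subset[of G lab X] by blast
    ultimately show ?thesis by blast
  next
    case False
    then show ?thesis unfolding tree_verts_def by blast
  qed
next
  fix S X Y w
  assume XY: "rel.sides S X Y" and card: "card (S \<inter> rel.cuts) = 1" and w: "w \<in> X - rel.cuts"
  note B = sides_V12_cases[OF XY]
  have "min_non_cut G lab X \<noteq> {}" using w by (intro min_non_cut_nonempty) (simp add: cut_vertices_eq)
  then obtain u where u: "u \<in> min_non_cut G lab X" by blast
  have "leaf_block G (G \<restriction> S)" using card unfolding leaf_block_def by (simp add: cut_vertices_eq)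
  from subsetD[OF NC_leaf[OF B(1) this], of u] have "u \<in> NC G lab V1 V2 (G \<restriction> S)"
    using B(2) u by auto
  then have "u \<in> tree_verts" using B(1) unfolding tree_verts_def by blast
  moreover have "u \<in> X - rel.cuts" using u min_non_cut_subset[of G lab X] unfolding cut_vertices_eq by blast
  ultimately show "\<exists>u \<in> X - rel.cuts. u \<in> tree_verts" by blast
qed

lemma gcenter_tree:
  "gcenter (assoc_tree G lab V1 V2) = centre tree_verts (rel_on (arcs_ends G) tree_verts)"
proof -
  interpret T: wf_digraph "G \<restriction> tree_verts" by (rule wellformed_induce_subgraph)
  show ?thesis
    using T.gcenter_eq_centre tree.finite_W tree.W_nonempty
    unfolding assoc_tree_def tree_verts_def[symmetric] by (simp add: arcs_ends_induce)
qed

lemma gcenter_G: "gcenter G = centre (verts G) (arcs_ends G)"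
  using gcenter_eq_centre rel.fin rel.nonempty by blast

lemma gcenter_all_cuts:
  "gcenter (assoc_tree G lab V1 V2) \<subseteq> cut_vertices G \<Longrightarrow>
    gcenter G = gcenter (assoc_tree G lab V1 V2)"
  using tree.centre_all_cuts unfolding gcenter_tree gcenter_G cut_vertices_eq .

lemma gcenter_one_noncut:
  assumes "gcenter (assoc_tree G lab V1 V2) - cut_vertices G = {z}"
    and "B \<in> blocks G" "X = V1 B \<or> X = V2 B" "z \<in> X"
  shows "gcenter G = (gcenter (assoc_tree G lab V1 V2) \<inter> cut_vertices G) \<union> X"
proof -
  obtain Y where "rel.sides (verts B) X Y"
    using sides_V12[OF assms(2)] rel.sides_sym assms(3) by blast
  then show ?thesis
    using tree.centre_one_noncut assms(1,4) unfolding gcenter_tree gcenter_G cut_vertices_eq by blast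
qed

end

theorem theorem3p14:
  fixes G :: "('a, 'b) pre_digraph"
    and lab :: "'a \<Rightarrow> nat"
    and V1 V2 :: "('a, 'b) pre_digraph \<Rightarrow> 'a set"
  assumes "class_B G"
    and "labelling G lab"
    and "\<And>B. B \<in> blocks G \<Longrightarrow> bipartition B (V1 B) (V2 B)"
    and "diam G \<ge> 4"
  shows
    "(\<forall>z B. even (diam G) \<and> gcenter (assoc_tree G lab V1 V2) = {z} \<and> B \<in> blocks G \<and> z \<in> V1 B \<longrightarrow>
        (z \<in> cut_vertices G \<longrightarrow> gcenter G = {z}) \<and>
        (z \<notin> cut_vertices G \<longrightarrow> gcenter G = V1 B)) \<and>
     (\<forall>z1 z2 B. odd (diam G) \<and> gcenter (assoc_tree G lab V1 V2) = {z1, z2} \<and>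
          B \<in> blocks G \<and> z1 \<in> V1 B \<and> z2 \<in> V2 B \<longrightarrow>
        (z1 \<in> cut_vertices G \<and> z2 \<in> cut_vertices G \<longrightarrow> gcenter G = {z1, z2}) \<and>
        (z1 \<in> cut_vertices G \<and> z2 \<notin> cut_vertices G \<longrightarrow> gcenter G = {z1} \<union> V2 B) \<and>
        (z1 \<notin> cut_vertices G \<and> z2 \<in> cut_vertices G \<longrightarrow> gcenter G = {z2} \<union> V1 B))"
proof -
  interpret graph G using assms(1) unfolding class_B_def bi_block_graph_def by blast
  interpret class_B_graph G lab V1 V2
    using assms(1,3) by unfold_locales (auto simp: class_B_def bi_block_graph_def)
  show ?thesis
  proof (intro conjI allI impI; elim conjE)
    fix z B
    assume T: "gcenter (assoc_tree G lab V1 V2) = {z}" and B: "B \<in> blocks G" "z \<in> V1 B"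
    show "gcenter G = {z}" if "z \<in> cut_vertices G"
      using gcenter_all_cuts T that by auto
    show "gcenter G = V1 B" if "z \<notin> cut_vertices G"
      using gcenter_one_noncut[OF _ B(1) _ B(2)] T that by auto
  next
    \<comment> \<open>Each of the three cases leaves at most one non-cut-vertex in the centre of the
      tree, so \<open>gcenter_all_cuts\<close> or \<open>gcenter_one_noncut\<close> applies.\<close>
    fix z1 z2 B
    assume T: "gcenter (assoc_tree G lab V1 V2) = {z1, z2}"
      and B: "B \<in> blocks G" "z1 \<in> V1 B" "z2 \<in> V2 B"
    show "gcenter G = {z1, z2}" if "z1 \<in> cut_vertices G" "z2 \<in> cut_vertices G"
      using gcenter_all_cuts T that by auto
    show "gcenter G = {z1} \<union> V2 B" if "z1 \<in> cut_vertices G" "z2 \<notin> cut_vertices G"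
      using gcenter_one_noncut[OF _ B(1) _ B(3)] T that by auto
    show "gcenter G = {z2} \<union> V1 B" if "z1 \<notin> cut_vertices G" "z2 \<in> cut_vertices G"
      using gcenter_one_noncut[OF _ B(1) _ B(2)] T that by auto
  qed
qed

end
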